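(* Let $n,k\ge1$ and let $V:=\{\pm e_1,\ldots,\pm e_n\}$, where $e_1,\ldots,e_n$ is a basis of $\mathbb R^n$. Let $\mathcal F=\{F_1,F_{-1},\ldots,F_n,F_{-n}\}$ be a cover of the unit ball $\mathbb B^k$, and put $S_j:=F_j\cap\mathbb S^{k-1}$ for $j\in\{\pm1,\ldots,\pm n\}$, where $\mathbb S^{k-1}=\partial\mathbb B^k$. (1) If $\mathcal F$ is not null-homotopic on the boundary, i.e. the cover $\mathcal S=\{S_j\}_{j\in\{\pm1,\ldots,\pm n\}}$ of $\mathbb S^{k-1}$ is not null-homotopic with respect to $V$, then there is $i\in\{1,\ldots,n\}$ such that $F_i\cap F_{-i}\neq\emptyset$. (2) In particular, if $\mathcal F$ is antipodally symmetric on the boundary of $\mathbb B^k$, i.e. $S_{-i}=-S_i$ for all $i$, then there is $i\in\{1,\ldots,n\}$ such that $F_i\cap F_{-i}\ne\emptyset$.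
   Context: A cover of a space $T$ is a finite indexed family of subsets whose union is $T$ and which are either all open or all closed in $T$. $[T,Y]$ is the set of homotopy classes of continuous maps $T\to Y$; $[f]\ne 0$ means that $f$ is not homotopic to a constant map. The index set is $I=\{+1,-1,\ldots,+n,-n\}$, with $v_i=e_i$ and $v_{-i}=-e_i$ for $i=1,\ldots,n$; the center of mass of $V$ is $c_V=0$. A nonempty subset $\mathcal B\subset I$ is balanced with respect to $V$ if $0\in\operatorname{conv}\{v_j:j\in\mathcal B\}$. Homotopy class of a cover with respect to $V$: let $\mathcal U=\{U_j\}_{j\in I}$ be an open cover of a normal space $T$ such that $\bigcap_{j\in\mathcal B}U_j=\emptyset$ for every balanced $\mathcal B$, and let $\{\varphi_j\}_{j\in I}$ be a partition of unity with $\operatorname{supp}\varphi_j\subset U_j$. Put $\rho(x)=\sum_{j\in I}\varphi_j(x)v_j$. Then $\rho(x)\neq0$ for all $x\in T$, and $f_{\mathcal U,V}(x)=\rho(x)/\|\rho(x)\|$ is a continuous map $T\to\mathbb S^{n-1}$ whose homotopy class $\mu(\mathcal U,V)\in[T,\mathbb S^{n-1}]$ does not depend on the partition of unity. For a closed cover $\mathcal S=\{S_j\}_{j\in I}$ of $T$ such that $\bigcap_{j\in\mathcal B}S_j=\emptyset$ for every balanced $\mathcal B$, put $\mu(\mathcal S,V):=\mu(\mathcal U,V)$ for any open cover $\mathcal U$ with $S_j\subset U_j$ and $\bigcap_{j\in\mathcal B}U_j=\emptyset$ for every balanced $\mathcal B$ (this does not depend on the choice of $\mathcal U$). A cover $\mathcal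 S=\{S_j\}_{j\in I}$ of $T$ is not null-homotopic with respect to $V$ if $\bigcap_{j\in\mathcal B}S_j=\emptyset$ for every balanced $\mathcal B\subset I$ and $\mu(\mathcal S,V)\ne0$ in $[T,\mathbb S^{n-1}]$. In part (2) the antipodal symmetry on the boundary takes the place of the hypothesis of part (1): the cover is not separately assumed to be not null-homotopic on the boundary.
   Formalization: Part (2) is stated only for n ≤ k, since it fails for every k < n: for k=1, n=2 take F_1=[1/2,1], F_{-1}=[-1,-1/2], F_2=[-1/2,1/2], F_{-2}=∅. Part (1) is stated for all n,k ≥ 1. *)

theory Defs
  imports "HOL-Analysis.Analysis"
begin

definition is_cover :: "'b topology \<Rightarrow> 'i set \<Rightarrow> ('i \<Rightarrow> 'b set) \<Rightarrow> bool" where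
  "is_cover T I U \<longleftrightarrow>
     finite I \<and> (\<Union>j\<in>I. U j) = topspace T \<and>
     ((\<forall>j\<in>I. openin T (U j)) \<or> (\<forall>j\<in>I. closedin T (U j)))"

definition homotopy_class :: "'b topology \<Rightarrow> 'c topology \<Rightarrow> ('b \<Rightarrow> 'c) \<Rightarrow> ('b \<Rightarrow> 'c) set" where
  "homotopy_class X Y f = {g. homotopic_with (\<lambda>_. True) X Y f g}"

definition null_class :: "'b topology \<Rightarrow> 'c topology \<Rightarrow> ('b \<Rightarrow> 'c) set \<Rightarrow> bool" where
  "null_class X Y c \<longleftrightarrow> (\<exists>y\<in>topspace Y. c = homotopy_class X Y (\<lambda>_. y))"

text \<open>Balancedness is with respect to the center of mass of the vectors, which is the origin for
  the configurations considered here.\<close>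

definition balanced :: "'i set \<Rightarrow> ('i \<Rightarrow> 'a::real_vector) \<Rightarrow> 'i set \<Rightarrow> bool" where
  "balanced I v B \<longleftrightarrow> B \<noteq> {} \<and> B \<subseteq> I \<and> 0 \<in> convex hull (v ` B)"

definition balanced_free :: "'i set \<Rightarrow> ('i \<Rightarrow> 'a::real_vector) \<Rightarrow> ('i \<Rightarrow> 'b set) \<Rightarrow> bool" where
  "balanced_free I v U \<longleftrightarrow> (\<forall>B. balanced I v B \<longrightarrow> (\<Inter>j\<in>B. U j) = {})"

definition partition_of_unity ::
    "'b topology \<Rightarrow> 'i set \<Rightarrow> ('i \<Rightarrow> 'b set) \<Rightarrow> ('i \<Rightarrow> 'b \<Rightarrow> real) \<Rightarrow> bool" where
  "partition_of_unity T I U \<phi> \<longleftrightarrow>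
     (\<forall>j\<in>I. continuous_map T euclideanreal (\<phi> j) \<and>
            (\<forall>x\<in>topspace T. 0 \<le> \<phi> j x) \<and>
            T closure_of {x \<in> topspace T. \<phi> j x \<noteq> 0} \<subseteq> U j) \<and>
     (\<forall>x\<in>topspace T. (\<Sum>j\<in>I. \<phi> j x) = 1)"

definition cover_map ::
    "'i set \<Rightarrow> ('i \<Rightarrow> 'a::euclidean_space) \<Rightarrow> ('i \<Rightarrow> 'b \<Rightarrow> real) \<Rightarrow> 'b \<Rightarrow> 'a" where
  "cover_map I v \<phi> x =
     (\<Sum>j\<in>I. \<phi> j x *\<^sub>R v j) /\<^sub>R norm (\<Sum>j\<in>I. \<phi> j x *\<^sub>R v j)"

text \<open>The classes below do not depend on the chosen partition of unity, nor on the chosen open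
  enlargement of a closed cover, as long as \<open>T\<close> is normal and the cover is balanced-free; the
  choice operator selects one of them. For a cover that is both open and closed the two
  constructions agree.\<close>

definition open_cover_class ::
    "'b topology \<Rightarrow> 'i set \<Rightarrow> ('i \<Rightarrow> 'a::euclidean_space) \<Rightarrow> ('i \<Rightarrow> 'b set) \<Rightarrow> ('b \<Rightarrow> 'a) set" where
  "open_cover_class T I v U =
     homotopy_class T (top_of_set (sphere 0 1))
       (cover_map I v (SOME \<phi>. partition_of_unity T I U \<phi>))"

definition open_enlargement ::
    "'b topology \<Rightarrow> 'i set \<Rightarrow> ('i \<Rightarrow> 'a::real_vector) \<Rightarrow> ('i \<Rightarrow> 'b set) \<Rightarrow> ('i \<Rightarrow> 'b set) \<Rightarrow> bool" where
  "open_enlargement T I v S U \<longleftrightarrow>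
     is_cover T I U \<and> (\<forall>j\<in>I. openin T (U j) \<and> S j \<subseteq> U j) \<and> balanced_free I v U"

definition cover_class ::
    "'b topology \<Rightarrow> 'i set \<Rightarrow> ('i \<Rightarrow> 'a::euclidean_space) \<Rightarrow> ('i \<Rightarrow> 'b set) \<Rightarrow> ('b \<Rightarrow> 'a) set" where
  "cover_class T I v S =
     (if \<forall>j\<in>I. openin T (S j) then open_cover_class T I v S
      else open_cover_class T I v (SOME U. open_enlargement T I v S U))"

definition not_null_homotopic_cover ::
    "'b topology \<Rightarrow> 'i set \<Rightarrow> ('i \<Rightarrow> 'a::euclidean_space) \<Rightarrow> ('i \<Rightarrow> 'b set) \<Rightarrow> bool" where
  "not_null_homotopic_cover T I v S \<longleftrightarrow>
     is_cover T I S \<and> balanced_free I v S \<and>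
     \<not> null_class T (top_of_set (sphere 0 1)) (cover_class T I v S)"

definition signed_indices :: "nat \<Rightarrow> int set" where
  "signed_indices n = {j. 1 \<le> \<bar>j\<bar> \<and> \<bar>j\<bar> \<le> int n}"

definition signed_vector :: "(nat \<Rightarrow> 'a::real_vector) \<Rightarrow> int \<Rightarrow> 'a" where
  "signed_vector e j = (if 0 < j then e (nat j) else - e (nat (- j)))"

definition antipodal_on_sphere :: "nat \<Rightarrow> (int \<Rightarrow> 'b::euclidean_space set) \<Rightarrow> bool" where
  "antipodal_on_sphere n F \<longleftrightarrow>
     (\<forall>j\<in>signed_indices n. F (- j) \<inter> sphere 0 1 = uminus ` (F j \<inter> sphere 0 1))"

text \<open>Antipodal symmetry on the boundary of the \<open>k\<close>-ball forces \<open>F\<^sub>i \<inter> F\<^bsub>-i\<^esub> \<noteq> \<emptyset>\<close> for some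
  \<open>i \<le> n\<close> only when \<open>n \<le> k\<close>. For \<open>k = 1\<close>, \<open>n = 2\<close> the following closed cover
  of \<open>[-1, 1]\<close> is a counterexample.\<close>

lemma antipodal_cover_without_crossing:
  "\<exists>F :: int \<Rightarrow> (real ^ 1) set.
     is_cover (top_of_set (cball 0 1)) (signed_indices 2) F \<and>
     antipodal_on_sphere 2 F \<and>
     (\<forall>i\<in>{1..2}. F (int i) \<inter> F (- int i) = {})"
proof -
  define F :: "int \<Rightarrow> (real ^ 1) set" where
    "F j = (if j = 1 then {x. x $ 1 \<in> {1/2..1}}
            else if j = -1 then {x. x $ 1 \<in> {-1..-1/2}}
            else if j = 2 then {x. x $ 1 \<in> {-1/2..1/2}} else {})" for j
  have I: "signed_indices 2 = {1, -1, 2, -2}"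
    by (auto simp: signed_indices_def)
  have norm1: "norm x = \<bar>x $ 1\<bar>" for x :: "real ^ 1"
    by (simp add: norm_vec_def)
  have cb: "cball 0 1 = {x :: real ^ 1. x $ 1 \<in> {-1..1}}"
    by (auto simp: norm1)
  have closed_slab: "closed {x :: real ^ 1. x $ 1 \<in> {a..b}}" for a b :: real
  proof -
    have "closed ((\<lambda>x :: real ^ 1. x $ 1) -` {a..b})"
      by (intro closed_vimage closed_atLeastAtMost continuous_intros)
    then show ?thesis by (simp add: vimage_def)
  qed
  have "closed (F j)" for j
    unfolding F_def
    using closed_slab[of "1/2" 1] closed_slab[of "-1" "-1/2"] closed_slab[of "-1/2" "1/2"] by simp
  moreover have un: "(\<Union>j\<in>signed_indices 2. F j) = cball 0 1"
    unfolding I cb by (auto simp: F_def)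
  ultimately have "\<forall>j\<in>signed_indices 2. closedin (top_of_set (cball 0 1)) (F j)"
    by (metis UN_upper closed_subset)
  then have "is_cover (top_of_set (cball 0 1)) (signed_indices 2) F"
    unfolding is_cover_def using un by (simp add: I)
  moreover have "antipodal_on_sphere 2 F"
    unfolding antipodal_on_sphere_def I
  proof (intro ballI set_eqI)
    fix j :: int and x :: "real ^ 1"
    assume "j \<in> {1, -1, 2, -2}"
    then have "x \<in> F (- j) \<inter> sphere 0 1 \<longleftrightarrow> - x \<in> F j \<inter> sphere 0 1"
      by (auto simp: F_def norm1)
    also have "\<dots> \<longleftrightarrow> x \<in> uminus ` (F j \<inter> sphere 0 1)"
      by (metis (no_types, lifting) image_iff minus_minus)
    finally show "x \<in> F (- j) \<inter> sphere 0 1 \<longleftrightarrow> x \<in> uminus ` (F j \<inter> sphere 0 1)" .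
  qed
  moreover have "\<forall>i\<in>{1..2}. F (int i) \<inter> F (- int i) = {}"
    by (auto simp: F_def)
  ultimately show ?thesis by blast
qed

end

theory Submission
  imports Defs "HOL-Homology.Simplices" "HOL-Library.Multiset"
begin

text \<open>Suppose that no \<open>F i\<close> meets \<open>F (-i)\<close>. The cover can be shrunk to a cover \<open>G\<close> of the ball by compact
  sets (\<open>compact_shrinking\<close>), so that opposite sets have positive distance.

  For part (1), take a partition of unity on the ball supported in thin neighbourhoods of the sets
  \<open>G j\<close>. At no point do two opposite indices both have positive weight. The vectors with positive
  weight therefore lie in a hyperplane off the origin (\<open>signed_functional\<close>), and the weighted sum of
  vectors never vanishes. After normalisation it is a map from the ball to the sphere, so its
  restriction to the boundary is null-homotopic. This restriction represents the class of the
  boundary cover: any two partitions of unity subordinate to the same balanced-free cover give maps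
  that are homotopic along segments (\<open>open_cover_class_null\<close>).

  For part (2), label each point of the ball by an index \<open>j\<close> with the point in \<open>G j\<close>, choosing opposite
  labels at antipodal points of the boundary. Opposite labels are then a positive distance apart,
  and the argument is Ky Fan's proof of Tucker's lemma, carried out with singular chains instead of
  a symmetric triangulation. Let \<open>a\<close> be the antipodal map. On spheres of dimension 0, 1, 2, ... there are
  chains \<open>c p\<close> with boundary \<open>\<partial> c (p + 1) = c p - (-1)^p a (c p)\<close>, because the right-hand side is a cycle in
  a sphere that contracts inside the next one; the last filling takes place in the ball. Call
  a simplex alternating if the labels of its vertices, sorted by modulus, alternate in
  sign. For a fine subdivision, the number of alternating simplices has the same parity for \<open>c p\<close> and
  \<open>c (p + 1)\<close> (\<open>filling_antipodal_diff\<close>), and it is 1 for the point \<open>c 0\<close>. So the filling in the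
  ball contains an alternating simplex of dimension \<open>k\<close>, and as small simplices
  carry no opposite labels, its \<open>k + 1\<close> labels have distinct moduli. This is impossible with \<open>n \<le> k\<close>
  moduli.\<close>

section \<open>Alternating label sequences\<close>

text \<open>Signed labels are coded by natural numbers: \<open>2 * i\<close> stands for \<open>+i\<close> and \<open>2 * i + 1\<close> for \<open>-i\<close>.
  The usual order then sorts labels by modulus \<open>l div 2\<close>, with the two labels of one modulus
  adjacent; reversing the sign is \<open>antilabel\<close>.\<close>

definition antilabel :: "nat \<Rightarrow> nat" where
  "antilabel l = (if even l then l + 1 else l - 1)"

lemma antilabel_div_2 [simp]: "antilabel l div 2 = l div 2"
  by (auto simp: antilabel_def elim!: oddE)

lemma even_antilabel [simp]: "even (antilabel l) \<longleftrightarrow> odd l"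
  by (auto simp: antilabel_def)

lemma same_modulus: "l div 2 = m div 2 \<Longrightarrow> m = l \<or> m = antilabel l"
  by (auto simp: antilabel_def elim!: oddE evenE)

fun alternating :: "bool \<Rightarrow> nat list \<Rightarrow> bool" where
  "alternating s [] \<longleftrightarrow> True"
| "alternating s (l # ls) \<longleftrightarrow> (even l \<longleftrightarrow> s) \<and> alternating (\<not> s) ls"

fun deletions :: "'a list \<Rightarrow> 'a list list" where
  "deletions [] = []"
| "deletions (x # xs) = xs # map ((#) x) (deletions xs)"

text \<open>A combinatorial form of Ky Fan's parity argument. An alternating sequence of at least two entries
  stays alternating only when an end entry is deleted, and exactly one of the two ends leaves a
  sequence that starts with the sign \<open>s\<close>. A sequence that is not alternating can be repaired by one
  deletion only if it has exactly one pair of equal adjacent signs, and deleting either member of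
  the pair gives the same signs, so the number of repairs is even.\<close>

lemma even_alternating_deletions:
  "even (sum_list (map (\<lambda>ys. of_bool (alternating s ys) :: int) (deletions xs))
     - of_bool (alternating True xs) - of_bool (alternating False xs))"
proof (induction xs arbitrary: s)
  case (Cons x xs)
  have "sum_list (map (\<lambda>ys. of_bool (alternating s ys) :: int) (map ((#) x) ds)) =
     of_bool (even x \<longleftrightarrow> s) * sum_list (map (\<lambda>ys. of_bool (alternating (\<not> s) ys)) ds)" for ds
    by (induction ds) (auto simp: algebra_simps)
  then show ?case
    using Cons.IH[of "\<not> s"]
    by (cases s; cases "even x") auto
qed auto

lemma sorted_deletions: "sorted xs \<Longrightarrow> ys \<in> set (deletions xs) \<Longrightarrow> sorted ys"
proof -
  have sub: "ys \<in> set (deletions xs) \<Longrightarrow> set ys \<subseteq> set xs" for xs ys :: "'a list"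
    by (induction xs arbitrary: ys) fastforce+
  show "sorted xs \<Longrightarrow> ys \<in> set (deletions xs) \<Longrightarrow> sorted ys"
    by (induction xs arbitrary: ys) (use sub in fastforce)+
qed

lemma mset_deletions: "map mset (deletions xs) = map (\<lambda>x. mset xs - {#x#}) xs"
proof (induction xs)
  case (Cons a xs)
  have "map mset (map ((#) a) (deletions xs)) = map (add_mset a) (map mset (deletions xs))"
    by simp
  also have "\<dots> = map (\<lambda>x. mset (a # xs) - {#x#}) xs"
    unfolding Cons.IH by (simp add: diff_union_swap2)
  finally show ?case by simp
qed simp

text \<open>Multisets rather than sets, so that a label carried by two vertices yields two equal adjacent
  signs and hence a simplex that is not alternating.\<close>

definition alternating_mset :: "bool \<Rightarrow> nat multiset \<Rightarrow> bool" where
  "alternating_mset s M \<longleftrightarrow> alternating s (sorted_list_of_multiset M)"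

lemma even_alternating_facets:
  "even ((\<Sum>l\<in>#M. of_bool (alternating_mset s (M - {#l#})) :: int)
     - of_bool (alternating_mset True M) - of_bool (alternating_mset False M))"
proof -
  define xs where "xs = sorted_list_of_multiset M"
  have xs: "sorted xs" "mset xs = M"
    by (auto simp: xs_def)
  have "(\<Sum>l\<in>#M. of_bool (alternating_mset s (M - {#l#})) :: int)
      = sum_list (map (\<lambda>N. of_bool (alternating_mset s N)) (map mset (deletions xs)))"
    unfolding mset_deletions by (simp add: xs(2)[symmetric] comp_def sum_mset_sum_list flip: mset_map)
  also have "\<dots> = sum_list (map (\<lambda>ys. of_bool (alternating s ys)) (deletions xs))"
    unfolding alternating_mset_def
    by (auto simp: comp_def sorted_deletions[OF xs(1)] sorted_list_of_multiset_mset sorted_sort_id intro!: arg_cong[where f=sum_list])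
  finally show ?thesis
    using even_alternating_deletions[of s xs] by (simp add: alternating_mset_def flip: xs_def)
qed

lemma alternating_antilabel: "alternating s (map antilabel xs) \<longleftrightarrow> alternating (\<not> s) xs"
  by (induction xs arbitrary: s) auto

text \<open>When no two opposite labels occur, reversing all signs preserves the order of the labels, because
  then distinct labels have distinct moduli.\<close>

lemma alternating_mset_antilabel:
  assumes "\<And>l. l \<in># M \<Longrightarrow> antilabel l \<notin># M"
  shows "alternating_mset s (image_mset antilabel M) \<longleftrightarrow> alternating_mset (\<not> s) M"
proof -
  define xs where "xs = sorted_list_of_multiset M"
  have xs: "sorted xs" "mset xs = M" "set xs = set_mset M"
    by (auto simp: xs_def)
  have "antilabel l \<le> antilabel m" if "l \<in> set xs" "m \<in> set xs" "l \<le> m" for l m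
  proof (cases "l div 2 = m div 2")
    case True
    with that assms xs(3) same_modulus show ?thesis
      by fastforce
  next
    case False
    then have "antilabel l div 2 < antilabel m div 2"
      using \<open>l \<le> m\<close> by (simp add: div_le_mono le_neq_implies_less)
    then show ?thesis
      by (metis div_le_mono leD le_cases)
  qed
  then have "sorted (map antilabel xs)"
    unfolding sorted_map by (rule sorted_wrt_mono_rel[OF _ xs(1)])
  then have "sorted_list_of_multiset (image_mset antilabel M) = map antilabel xs"
    by (metis xs(2) mset_map sorted_list_of_multiset_mset sorted_sort_id)
  then show ?thesis
    by (simp add: alternating_mset_def alternating_antilabel flip: xs_def)
qed

text \<open>Adjacent entries differ in sign; since opposite labels are excluded they differ in modulus, so the
  moduli are strictly increasing.\<close>

lemma card_moduli_alternating:
  assumes "\<And>l. l \<in># M \<Longrightarrow> antilabel l \<notin># M" and "alternating_mset s M"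
  shows "card ((\<lambda>l. l div 2) ` set_mset M) = size M"
proof -
  define xs where "xs = sorted_list_of_multiset M"
  have xs: "sorted xs" "mset xs = M" "set xs = set_mset M" "alternating s xs"
    using assms(2) by (auto simp: xs_def alternating_mset_def)
  have "\<forall>l\<in>set xs. antilabel l \<notin> set xs"
    using assms(1) xs(3) by simp
  then have "distinct (map (\<lambda>l. l div 2) xs)"
    using xs(1,4)
  proof (induction xs arbitrary: s)
    case (Cons x xs)
    have ne: "y div 2 \<noteq> x div 2" if y: "y \<in> set xs" for y
    proof
      assume "y div 2 = x div 2"
      then have "y = x \<or> y = antilabel x"
        by (intro same_modulus) simp
      with Cons.prems(1) y have "y = x"
        by force
      obtain z zs where z: "xs = z # zs"
        using y by (cases xs) simp_all
      have "x \<le> z" "z \<le> y"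
        using Cons.prems(2) y z by auto
      with \<open>y = x\<close> have "z = x"
        by simp
      with Cons.prems(3) z show False
        by (cases s) auto
    qed
    have "distinct (map (\<lambda>l. l div 2) xs)"
      using Cons.prems by (intro Cons.IH[of "\<not> s"]) simp_all
    then show ?case
      using ne by fastforce
  qed simp
  then have "card (set (map (\<lambda>l. l div 2) xs)) = length xs"
    by (simp only: distinct_card length_map)
  moreover have "length xs = size M"
    using xs(2) by force
  ultimately show ?thesis
    by (simp add: xs(3))
qed

section \<open>Counting alternating simplices in a chain\<close>

text \<open>The linear extension of a function on simplices to chains. Only its parity matters below, which makes
  it a cochain with coefficients modulo 2.\<close>

definition chain_weight :: "('a \<Rightarrow> int) \<Rightarrow> ('a \<Rightarrow>\<^sub>0 int) \<Rightarrow> int" where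
  "chain_weight w c = (\<Sum>f\<in>Poly_Mapping.keys c. Poly_Mapping.lookup c f * w f)"

lemma chain_weight_superset:
  assumes "finite A" "Poly_Mapping.keys c \<subseteq> A"
  shows "chain_weight w c = (\<Sum>f\<in>A. Poly_Mapping.lookup c f * w f)"
  unfolding chain_weight_def using assms
  by (intro sum.mono_neutral_left) (auto simp: in_keys_iff)

lemma chain_weight_0 [simp]: "chain_weight w 0 = 0"
  by (simp add: chain_weight_def)

lemma chain_weight_of [simp]: "chain_weight w (frag_of f) = w f"
  by (simp add: chain_weight_def keys_frag_of)

lemma chain_weight_diff: "chain_weight w (a - b) = chain_weight w a - chain_weight w b"
proof -
  let ?A = "Poly_Mapping.keys a \<union> Poly_Mapping.keys b"
  have "chain_weight w c = (\<Sum>f\<in>?A. Poly_Mapping.lookup c f * w f)"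
    if "c \<in> {a, b, a - b}" for c
    using that keys_diff[of a b] by (intro chain_weight_superset) auto
  then show ?thesis
    by (simp add: lookup_minus left_diff_distrib sum_subtractf)
qed

lemma chain_weight_minus: "chain_weight w (- c) = - chain_weight w c"
  using chain_weight_diff[of w 0 c] by simp

lemma chain_weight_add: "chain_weight w (a + b) = chain_weight w a + chain_weight w b"
  using chain_weight_diff[of w a "- b"] by (simp add: chain_weight_minus)

lemma chain_weight_sum: "chain_weight w (sum c A) = (\<Sum>i\<in>A. chain_weight w (c i))"
  by (induction A rule: infinite_finite_induct) (auto simp: chain_weight_add)

lemma chain_weight_sign:
  "chain_weight w (frag_cmul ((-1) ^ k) c) = (-1) ^ k * chain_weight w c"
  by (cases "even k") (auto simp: chain_weight_minus)

lemma chain_weight_map: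
  "chain_weight w (frag_extend (frag_of \<circ> g) c) = chain_weight (w \<circ> g) c"
  using subset_UNIV[of "Poly_Mapping.keys c"]
  by (induction c rule: frag_induction) (auto simp: frag_extend_diff chain_weight_diff)

definition vertex_labels :: "('a \<Rightarrow> nat) \<Rightarrow> nat \<Rightarrow> ((nat \<Rightarrow> real) \<Rightarrow> 'a) \<Rightarrow> nat multiset" where
  "vertex_labels L p f = image_mset (\<lambda>i. L (simplicial_vertex i f)) (mset_set {..p})"

lemma simplicial_vertex_singular_face:
  assumes "j < p"
  shows "simplicial_vertex j (singular_face p i f) = simplicial_vertex (if j < i then j else Suc j) f"
proof -
  have "simplical_face i (\<lambda>m. if m = j then 1 else 0 :: real)
      = (\<lambda>m. if m = (if j < i then j else Suc j) then 1 else 0)"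
    by (auto simp: simplical_face_def fun_eq_iff)
  moreover have "j \<le> p - 1"
    using assms by simp
  ultimately show ?thesis
    by (simp add: simplicial_vertex_def singular_face_def)
qed

text \<open>The combinatorial deletion of a label is the passage to a facet, which turns the parity of
  deletions into a statement about the boundary operator.\<close>

lemma vertex_labels_singular_face:
  assumes "1 \<le> p" "i \<le> p"
  shows "vertex_labels L (p - 1) (singular_face p i f)
       = vertex_labels L p f - {#L (simplicial_vertex i f)#}"
proof -
  \<comment> \<open>the vertices of the facet opposite to vertex \<open>i\<close>\<close>
  define skip where "skip j = (if j < i then j else Suc j)" for j
  have "inj_on skip {..p - 1}"
    by (auto simp: inj_on_def skip_def split: if_splits)
  moreover have "skip ` {..p - 1} = {..p} - {i}"
  proof
    show "{..p} - {i} \<subseteq> skip ` {..p - 1}"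
    proof
      fix j assume j: "j \<in> {..p} - {i}"
      then have "j = skip (if j < i then j else j - 1)" "(if j < i then j else j - 1) \<in> {..p - 1}"
        using assms by (auto simp: skip_def)
      then show "j \<in> skip ` {..p - 1}"
        by (rule image_eqI)
    qed
  qed (use assms in \<open>auto simp: skip_def\<close>)
  ultimately have skip: "image_mset skip (mset_set {..p - 1}) = mset_set {..p} - {#i#}"
    using assms by (simp add: image_mset_mset_set mset_set_Diff)
  have "vertex_labels L (p - 1) (singular_face p i f)
      = image_mset (\<lambda>j. L (simplicial_vertex (skip j) f)) (mset_set {..p - 1})"
    unfolding vertex_labels_def
    by (intro image_mset_cong) (use assms in \<open>auto simp: simplicial_vertex_singular_face skip_def\<close>)
  also have "\<dots> = image_mset (\<lambda>j. L (simplicial_vertex j f)) (image_mset skip (mset_set {..p - 1}))"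
    by (simp add: multiset.map_comp comp_def)
  also have "\<dots> = vertex_labels L p f - {#L (simplicial_vertex i f)#}"
    unfolding skip vertex_labels_def using assms by (simp add: image_mset_Diff)
  finally show ?thesis .
qed

definition alternating_weight :: "('a \<Rightarrow> nat) \<Rightarrow> bool \<Rightarrow> nat \<Rightarrow> ((nat \<Rightarrow> real) \<Rightarrow> 'a) \<Rightarrow> int" where
  "alternating_weight L s p f = of_bool (alternating_mset s (vertex_labels L p f))"

definition alternating_count :: "('a \<Rightarrow> nat) \<Rightarrow> bool \<Rightarrow> nat \<Rightarrow> 'a chain \<Rightarrow> int" where
  "alternating_count L s p c = chain_weight (alternating_weight L s p) c"

text \<open>In cohomological terms: the coboundary modulo 2 of the cochain that detects alternating
  \<open>(p - 1)\<close>-simplices of a given initial sign detects the alternating \<open>p\<close>-simplices of both signs.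
  Summation over the facets of one simplex is \<open>even_alternating_facets\<close>.\<close>

lemma even_alternating_boundary:
  assumes "1 \<le> p"
  shows "even (alternating_count L s (p - 1) (chain_boundary p c)
           - alternating_count L True p c - alternating_count L False p c)"
  using subset_UNIV[of "Poly_Mapping.keys c"]
proof (induction c rule: frag_induction)
  case (one f)
  let ?M = "vertex_labels L p f" and ?w = "alternating_weight L s (p - 1)"
  have count: "alternating_count L s (p - 1) (chain_boundary p (frag_of f))
      = (\<Sum>i\<le>p. (-1) ^ i * ?w (singular_face p i f))"
    using assms
    by (simp add: chain_boundary_of alternating_count_def chain_weight_sum chain_weight_sign)
  have "even ((\<Sum>i\<le>p. (-1) ^ i * ?w (singular_face p i f)) - (\<Sum>i\<le>p. ?w (singular_face p i f)))"
    unfolding sum_subtractf[symmetric]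
  proof (rule dvd_sum)
    show "even ((-1) ^ i * ?w (singular_face p i f) - ?w (singular_face p i f))" for i
      by (cases "even i") auto
  qed
  moreover have "(\<Sum>i\<le>p. ?w (singular_face p i f))
      = (\<Sum>i\<le>p. of_bool (alternating_mset s (?M - {#L (simplicial_vertex i f)#})))"
    using vertex_labels_singular_face[OF assms, of _ L f]
    by (intro sum.cong) (auto simp: alternating_weight_def)
  moreover have "\<dots> = (\<Sum>l\<in>#?M. of_bool (alternating_mset s (?M - {#l#})))"
    by (simp only: vertex_labels_def sum_unfold_sum_mset multiset.map_comp comp_def)
  ultimately have "even (alternating_count L s (p - 1) (chain_boundary p (frag_of f))
      - (\<Sum>l\<in>#?M. of_bool (alternating_mset s (?M - {#l#}))))"
    by (simp only: count)
  from dvd_add[OF this even_alternating_facets[where M = ?M and s = s]] show ?case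
    by (simp add: alternating_count_def alternating_weight_def)
next
  case (diff a b)
  let ?e = "\<lambda>c. alternating_count L s (p - 1) (chain_boundary p c)
    - alternating_count L True p c - alternating_count L False p c"
  have "?e (a - b) = ?e a - ?e b"
    by (simp add: chain_boundary_diff alternating_count_def chain_weight_diff)
  with dvd_diff[OF diff] show ?case
    by (simp only:)
qed (simp add: alternating_count_def)

lemma simplicial_vertex_in_topspace:
  assumes "singular_chain p X c" "f \<in> Poly_Mapping.keys c" "i \<le> p"
  shows "simplicial_vertex i f \<in> topspace X"
proof -
  have "continuous_map (subtopology (powertop_real UNIV) (standard_simplex p)) X f"
    using assms by (auto simp: singular_chain_def singular_simplex_def)
  then have "f \<in> standard_simplex p \<rightarrow> topspace X"
    by (simp add: continuous_map_def topspace_standard_simplex)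
  then show ?thesis
    unfolding simplicial_vertex_def by (rule funcset_mem) (simp add: assms(3))
qed

text \<open>On a set where the labelling is odd, the antipodal map exchanges the two kinds of alternating
  simplices, provided the simplices are too small to carry opposite labels.\<close>

lemma alternating_count_chain_map_uminus:
  fixes c :: "'a::real_vector chain"
  assumes odd: "\<And>x. x \<in> topspace X \<Longrightarrow> L (- x) = antilabel (L x)"
    and c: "singular_chain p X c"
    and small: "\<And>f l. f \<in> Poly_Mapping.keys c \<Longrightarrow> l \<in># vertex_labels L p f
                  \<Longrightarrow> antilabel l \<notin># vertex_labels L p f"
  shows "alternating_count L s p (chain_map p uminus c) = alternating_count L (\<not> s) p c"
proof -
  have "alternating_weight L s p (simplex_map p uminus f) = alternating_weight L (\<not> s) p f"
    if f: "f \<in> Poly_Mapping.keys c" for f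
  proof -
    have "simplicial_vertex i f \<in> topspace X" if "i \<le> p" for i
      using c f that by (rule simplicial_vertex_in_topspace)
    then have "vertex_labels L p (simplex_map p uminus f) = image_mset antilabel (vertex_labels L p f)"
      unfolding vertex_labels_def multiset.map_comp
      by (intro image_mset_cong) (auto simp: odd[symmetric] simplicial_vertex_def simplex_map_def)
    then show ?thesis
      using alternating_mset_antilabel[OF small[OF f]] by (simp add: alternating_weight_def)
  qed
  then show ?thesis
    unfolding alternating_count_def chain_map_def chain_weight_map by (simp add: chain_weight_def)
qed

section \<open>Antipodal chains on nested spheres\<close>

lemma singular_chain_subdivision_power:
  "singular_chain p X c \<Longrightarrow> singular_chain p X ((singular_subdivision p ^^ m) c)"
  by (induction m) (auto simp: singular_chain_singular_subdivision)

lemma chain_boundary_subdivision_power: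
  "singular_chain p X c \<Longrightarrow> chain_boundary p ((singular_subdivision p ^^ m) c)
     = (singular_subdivision (p - 1) ^^ m) (chain_boundary p c)"
  by (induction m)
     (auto simp: chain_boundary_singular_subdivision[OF singular_chain_subdivision_power])

lemma subdivision_power_chain_map:
  "singular_chain p X c \<Longrightarrow> (singular_subdivision p ^^ m) (chain_map p g c)
     = chain_map p g ((singular_subdivision p ^^ m) c)"
  by (induction m)
     (auto simp: naturality_singular_subdivision[OF singular_chain_subdivision_power])

lemma subdivision_power_sign:
  "(singular_subdivision p ^^ m) (frag_cmul ((-1) ^ k) c)
     = frag_cmul ((-1) ^ k) ((singular_subdivision p ^^ m) c)"
  using singular_subdivision_power_diff[of m p 0 c] by (cases "even k") auto

text \<open>The two chain maps induced by the inclusion and by the constant map differ on \<open>z\<close> by a boundary,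
  and a constant cycle of positive dimension bounds. In dimension 0 it need not bound,
  hence the condition that its image vanishes.\<close>

lemma nullhomotopic_cycle_bounds:
  assumes hom: "homotopic_with (\<lambda>_. True) X Y id (\<lambda>_. b)" and b: "b \<in> topspace Y"
    and z: "singular_relcycle p X {} z" and z0: "p = 0 \<Longrightarrow> chain_map p (\<lambda>_. b) z = 0"
  obtains c where "singular_chain (Suc p) Y c" "chain_boundary (Suc p) c = z"
proof -
  have "homologous_rel p Y {} (chain_map p id z) (chain_map p (\<lambda>_. b) z)"
    by (rule homotopic_imp_homologous_rel_chain_maps[OF _ z]) (use hom in simp)
  moreover have "chain_map p id z = z"
    using z by (intro chain_map_id_gen[of p X]) (auto simp: singular_cycle)
  moreover have "singular_relboundary p Y {} (chain_map p (\<lambda>_. b) z)"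
  proof (cases "p = 0")
    case False
    have top: "topspace (subtopology Y {b}) = {b}"
      using b by auto
    have "singular_relcycle p (subtopology Y {b}) {} (chain_map p (\<lambda>_. b) z)"
      using z by (rule singular_relcycle_chain_map) (use b in auto)
    then have "singular_relboundary p (subtopology Y {b}) {} (chain_map p (\<lambda>_. b) z)"
      using singular_boundary_eq_cycle_singleton[OF top] False by simp
    then show ?thesis
      using b singular_boundary_mono[of "{b}" "topspace Y" p Y] by simp
  qed (use z0 in simp)
  ultimately have "singular_relboundary p Y {} z"
    using singular_relboundary_add[of p Y "{}" "z - chain_map p (\<lambda>_. b) z" "chain_map p (\<lambda>_. b) z"]
    by (simp add: homologous_rel_def)
  with that show ?thesis
    by (auto simp: singular_boundary)
qed

text \<open>The quantitative form of disjointness of opposite sets of a cover: points with opposite labels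
  are at distance at least \<open>\<delta>\<close>.\<close>

definition label_separated :: "('a::metric_space \<Rightarrow> nat) \<Rightarrow> real \<Rightarrow> 'a set \<Rightarrow> bool" where
  "label_separated L \<delta> S \<longleftrightarrow> (\<forall>x\<in>S. \<forall>y\<in>S. dist x y < \<delta> \<longrightarrow> L y \<noteq> antilabel (L x))"

lemma label_separated_subset: "label_separated L \<delta> T \<Longrightarrow> S \<subseteq> T \<Longrightarrow> label_separated L \<delta> S"
  by (auto simp: label_separated_def)

lemma fine_subdivision_labels:
  fixes c :: "'a::metric_space chain"
  assumes sep: "label_separated L \<delta> S" and "\<delta> > 0" and c: "singular_chain p (top_of_set S) c"
  obtains n where "\<And>m f l. \<lbrakk>n \<le> m; f \<in> Poly_Mapping.keys ((singular_subdivision p ^^ m) c);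
      l \<in># vertex_labels L p f\<rbrakk> \<Longrightarrow> antilabel l \<notin># vertex_labels L p f"
proof -
  define \<C> where "\<C> = (\<lambda>x. S \<inter> ball x (\<delta> / 2)) ` S"
  have "\<And>U. U \<in> \<C> \<Longrightarrow> openin (top_of_set S) U" "topspace (top_of_set S) \<subseteq> \<Union>\<C>"
    using \<open>\<delta> > 0\<close> by (auto simp: \<C>_def)
  from sufficient_iterated_singular_subdivision_exists[OF this c] obtain n where
    n: "\<And>m f. \<lbrakk>n \<le> m; f \<in> Poly_Mapping.keys ((singular_subdivision p ^^ m) c)\<rbrakk>
          \<Longrightarrow> \<exists>V\<in>\<C>. f \<in> standard_simplex p \<rightarrow> V"
    by metis
  show thesis
  proof
    fix m f l
    assume "n \<le> m" "f \<in> Poly_Mapping.keys ((singular_subdivision p ^^ m) c)"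
      and l: "l \<in># vertex_labels L p f"
    with n obtain x where x: "f \<in> standard_simplex p \<rightarrow> S \<inter> ball x (\<delta> / 2)"
      unfolding \<C>_def by blast
    have v: "simplicial_vertex i f \<in> S \<inter> ball x (\<delta> / 2)" if "i \<le> p" for i
      unfolding simplicial_vertex_def using that by (intro funcset_mem[OF x]) simp
    have "L (simplicial_vertex j f) \<noteq> antilabel (L (simplicial_vertex i f))"
      if "i \<le> p" "j \<le> p" for i j
    proof -
      have "dist (simplicial_vertex i f) (simplicial_vertex j f) < \<delta>"
        using v[OF that(1)] v[OF that(2)] by (metis IntD2 dist_triangle_half_r mem_ball)
      with sep v[OF that(1)] v[OF that(2)] show ?thesis
        by (auto simp: label_separated_def)
    qed
    with l show "antilabel l \<notin># vertex_labels L p f"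
      by (auto simp: vertex_labels_def) metis
  qed
qed

definition alternating_total :: "('a \<Rightarrow> nat) \<Rightarrow> nat \<Rightarrow> 'a chain \<Rightarrow> int" where
  "alternating_total L p c = alternating_count L True p c + alternating_count L False p c"

text \<open>With \<open>a\<close> for the antipodal map, this is \<open>c - (-1)^p a c\<close>. The sign makes it a cycle whenever
  \<open>c\<close> bounds the antipodal difference of a chain of one dimension less
  (\<open>boundary_antipodal_diff_filling\<close>), as for the two hemispheres of a sphere.\<close>

definition antipodal_diff :: "nat \<Rightarrow> 'a::real_vector chain \<Rightarrow> 'a chain" where
  "antipodal_diff p c = c - frag_cmul ((-1) ^ p) (chain_map p uminus c)"

text \<open>The induction step of Ky Fan's argument. Modulo 2, the alternating simplices of both signs in a
  subdivided filling \<open>c'\<close> are counted by those of positive sign in its boundary, which consists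
  of the subdivided \<open>c\<close> and its antipodal image; the latter contributes the alternating simplices of
  \<open>c\<close> with negative sign. So the total for \<open>c'\<close> has the parity of the total for \<open>c\<close>. Parity is
  claimed for all fine enough subdivisions, since a filling may have to be subdivided more often
  than the chain it bounds.\<close>

lemma filling_antipodal_diff:
  fixes c :: "'a::real_normed_vector chain"
  assumes L: "\<And>x. x \<in> S \<Longrightarrow> L (- x) = antilabel (L x)" "label_separated L \<delta> S" "\<delta> > 0"
    and S: "\<And>x. x \<in> S \<Longrightarrow> - x \<in> S"
    and c: "singular_chain p (top_of_set S) c" "chain_boundary p (antipodal_diff p c) = 0"
    and oddc: "\<forall>m\<ge>n. odd (alternating_total L p ((singular_subdivision p ^^ m) c))"
    and hom: "homotopic_with (\<lambda>_. True) (top_of_set S) (top_of_set T) id (\<lambda>_. b)" "b \<in> T"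
  obtains c' n' where "singular_chain (Suc p) (top_of_set T) c'"
    "chain_boundary (Suc p) c' = antipodal_diff p c"
    "\<forall>m\<ge>n'. odd (alternating_total L (Suc p) ((singular_subdivision (Suc p) ^^ m) c'))"
proof -
  have cont: "continuous_map (top_of_set S) (top_of_set S) uminus"
    using S by (auto intro!: continuous_intros)
  have ac: "singular_chain p (top_of_set S) (chain_map p uminus c)"
    using c(1) cont by (rule singular_chain_chain_map)
  have "singular_relcycle p (top_of_set S) {} (antipodal_diff p c)"
    unfolding singular_cycle antipodal_diff_def using c ac
    by (auto intro!: singular_chain_diff singular_chain_cmul simp: antipodal_diff_def)
  moreover have "chain_map p (\<lambda>_. b) (antipodal_diff p c) = 0" if "p = 0"
    using chain_map_compose[of p "\<lambda>_. b" "uminus :: 'a \<Rightarrow> 'a"] that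
    by (simp add: antipodal_diff_def chain_map_diff comp_def fun_eq_iff)
  ultimately obtain c' where c': "singular_chain (Suc p) (top_of_set T) c'"
    "chain_boundary (Suc p) c' = antipodal_diff p c"
    using nullhomotopic_cycle_bounds[OF hom(1)] hom(2) by (metis topspace_euclidean_subtopology)
  obtain n1 where n1: "\<And>m f l. \<lbrakk>n1 \<le> m; f \<in> Poly_Mapping.keys ((singular_subdivision p ^^ m) c);
      l \<in># vertex_labels L p f\<rbrakk> \<Longrightarrow> antilabel l \<notin># vertex_labels L p f"
    using fine_subdivision_labels[OF L(2,3) c(1)] by metis
  show thesis
  proof (rule that[OF c'], intro allI impI)
    fix m assume m: "max n n1 \<le> m"
    let ?d = "(singular_subdivision p ^^ m) c" and ?d' = "(singular_subdivision (Suc p) ^^ m) c'"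
    have d: "singular_chain p (top_of_set S) ?d"
      using c(1) by (rule singular_chain_subdivision_power)
    have "chain_boundary (Suc p) ?d' = antipodal_diff p ?d"
      using chain_boundary_subdivision_power[OF c'(1)]
      by (simp add: c'(2) antipodal_diff_def singular_subdivision_power_diff
          subdivision_power_sign subdivision_power_chain_map[OF c(1)])
    moreover have "alternating_count L True p (chain_map p uminus ?d) = alternating_count L (\<not> True) p ?d"
    proof (rule alternating_count_chain_map_uminus[OF _ d])
      show "antilabel l \<notin># vertex_labels L p f"
        if "f \<in> Poly_Mapping.keys ?d" "l \<in># vertex_labels L p f" for f l
        using n1[OF _ that] m by simp
    qed (use L(1) in simp)
    ultimately have "even (alternating_count L True p (chain_boundary (Suc p) ?d') - alternating_total L p ?d)"
      by (cases "even p")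
         (auto simp: antipodal_diff_def alternating_total_def alternating_count_def
           chain_weight_diff chain_weight_add)
    with even_alternating_boundary[of "Suc p" L True ?d'] oddc m
    show "odd (alternating_total L (Suc p) ?d')"
      by (auto simp: alternating_total_def)
  qed
qed

lemma boundary_antipodal_diff_filling:
  fixes c :: "'a::real_vector chain"
  assumes c: "singular_chain p X c" and c': "singular_chain (Suc p) Y c'"
    and b: "chain_boundary (Suc p) c' = antipodal_diff p c"
  shows "chain_boundary (Suc p) (antipodal_diff (Suc p) c') = 0"
proof -
  have "chain_map p uminus (chain_map p uminus c) = c"
    using chain_map_compose[of p uminus "uminus :: 'a \<Rightarrow> 'a"] chain_map_id_gen[OF c, of "uminus \<circ> uminus"]
    by (simp add: fun_eq_iff)
  then show ?thesis
    using chain_boundary_chain_map[OF c', of uminus] b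
    by (cases "even p")
       (auto simp: antipodal_diff_def chain_boundary_diff chain_boundary_add chain_map_diff
         chain_map_add chain_boundary_minus chain_map_minus)
qed

text \<open>\<open>U p\<close> is the unit sphere of dimension \<open>p\<close> in the span of the first \<open>p + 1\<close> basis vectors. The induction
  starts with a single point, which is an alternating simplex of exactly one sign. It proceeds since
  \<open>U p\<close> contracts inside \<open>U (Suc p)\<close> to the pole \<open>e (Suc p)\<close> along great circles.\<close>

lemma odd_alternating_chain_on_sphere:
  fixes e :: "nat \<Rightarrow> 'a::euclidean_space" and L :: "'a \<Rightarrow> nat"
  defines "U p \<equiv> {x. norm x = 1 \<and> (\<forall>i. p < i \<and> i < DIM('a) \<longrightarrow> x \<bullet> e i = 0)}"
  assumes e: "bij_betw e {..<DIM('a)} Basis"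
    and L: "\<And>x. x \<in> sphere 0 1 \<Longrightarrow> L (- x) = antilabel (L x)"
      "label_separated L \<delta> (sphere 0 1)" "\<delta> > 0"
    and p: "p < DIM('a)"
  shows "\<exists>c n. singular_chain p (top_of_set (U p)) c \<and> chain_boundary p (antipodal_diff p c) = 0 \<and>
     (\<forall>m\<ge>n. odd (alternating_total L p ((singular_subdivision p ^^ m) c)))"
proof -
  have orth: "e i \<bullet> e j = 0" if "i < DIM('a)" "j < DIM('a)" "i \<noteq> j" for i j
  proof -
    have "e i \<noteq> e j" "e i \<in> Basis" "e j \<in> Basis"
      using e that by (auto simp: bij_betw_def dest: inj_onD)
    then show ?thesis
      by (simp add: inner_Basis)
  qed
  show ?thesis
    using p
  proof (induction p)
    case 0
    define f where "f = (\<lambda>x\<in>standard_simplex 0. e 0)"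
    have "e 0 \<in> Basis"
      using e by (auto simp: bij_betw_def)
    moreover have "e 0 \<bullet> e i = 0" if "0 < i" "i < DIM('a)" for i
      using orth[of 0 i] that by simp
    ultimately have "e 0 \<in> U 0"
      by (auto simp: U_def)
    then have c: "singular_chain 0 (top_of_set (U 0)) (frag_of f)"
      by (simp add: singular_chain_of singular_simplex_def f_def)
    have "(singular_subdivision 0 ^^ m) (frag_of f) = frag_of f" for m
      by (induction m) (simp_all add: singular_subdivision_zero[OF c])
    moreover have "odd (alternating_total L 0 (frag_of f))"
      by (auto simp: alternating_total_def alternating_count_def alternating_weight_def
          vertex_labels_def alternating_mset_def)
    ultimately show ?case
      using c by (intro exI[of _ "frag_of f"] exI[of _ 0]) (simp add: chain_boundary_def)
  next
    case (Suc p)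
    then obtain c n where c: "singular_chain p (top_of_set (U p)) c" "chain_boundary p (antipodal_diff p c) = 0"
      and n: "\<forall>m\<ge>n. odd (alternating_total L p ((singular_subdivision p ^^ m) c))"
      by auto
    have U: "U p \<subseteq> sphere 0 1" "\<And>x. x \<in> U p \<Longrightarrow> - x \<in> U p"
      by (auto simp: U_def)
    have b: "e (Suc p) \<in> Basis"
      using e Suc.prems by (auto simp: bij_betw_def)
    define h where "h = (\<lambda>(t::real, x). cos (pi / 2 * t) *\<^sub>R x + sin (pi / 2 * t) *\<^sub>R e (Suc p))"
    have "h (t, x) \<in> U (Suc p)" if x: "x \<in> U p" for t x
    proof -
      have "x \<bullet> e (Suc p) = 0" "norm x = 1"
        using x Suc.prems by (auto simp: U_def)
      then have "(norm (h (t, x)))\<^sup>2 = (cos (pi / 2 * t))\<^sup>2 + (sin (pi / 2 * t))\<^sup>2"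
        using b unfolding h_def case_prod_conv
        by (simp add: norm_add_Pythagorean orthogonal_def power_mult_distrib)
      then have "norm (h (t, x)) = 1"
        by (metis norm_ge_zero one_power2 power2_eq_imp_eq sin_cos_squared_add2 zero_le_one)
      moreover have "h (t, x) \<bullet> e i = 0" if "Suc p < i" "i < DIM('a)" for i
        using x that orth[of "Suc p" i] by (auto simp: h_def U_def inner_left_distrib)
      ultimately show ?thesis
        by (simp add: U_def)
    qed
    then have "continuous_map (prod_topology (top_of_set {0..1}) (top_of_set (U p))) (top_of_set (U (Suc p))) h"
      unfolding prod_topology_subtopology_eu
      by (auto simp: h_def case_prod_beta intro!: continuous_intros)
    then have hom: "homotopic_with (\<lambda>_. True) (top_of_set (U p)) (top_of_set (U (Suc p))) id (\<lambda>_. e (Suc p))"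
      by (auto simp: homotopic_with h_def)
    have "e (Suc p) \<in> U (Suc p)"
      using b orth[of "Suc p"] by (auto simp: U_def)
    from filling_antipodal_diff[OF _ label_separated_subset[OF L(2) U(1)] L(3) U(2) c n hom this] L(1) U(1)
    obtain c' n' where c': "singular_chain (Suc p) (top_of_set (U (Suc p))) c'"
      "chain_boundary (Suc p) c' = antipodal_diff p c"
      "\<forall>m\<ge>n'. odd (alternating_total L (Suc p) ((singular_subdivision (Suc p) ^^ m) c'))"
      by (metis subsetD)
    with boundary_antipodal_diff_filling[OF c(1) c'(1,2)] show ?case
      by blast
  qed
qed

text \<open>A continuous version of the lemmas of Tucker and Ky Fan. The chain on the whole sphere is filled
  once more, in the ball, where the labelling need not be odd. A fine subdivision of the filling
  contains an odd number of alternating simplices of dimension \<open>DIM('a)\<close>, and the \<open>DIM('a) + 1\<close> labels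
  of one of them have distinct moduli.\<close>

theorem card_moduli_antipodal_labelling:
  fixes L :: "'a::euclidean_space \<Rightarrow> nat"
  assumes L: "\<And>x. x \<in> sphere 0 1 \<Longrightarrow> L (- x) = antilabel (L x)"
    and sep: "label_separated L \<delta> (cball 0 1)" "\<delta> > 0"
    and fin: "finite ((\<lambda>x. L x div 2) ` cball 0 1)"
  shows "DIM('a) < card ((\<lambda>x. L x div 2) ` cball 0 1)"
proof -
  obtain e :: "nat \<Rightarrow> 'a" where e: "bij_betw e {..<DIM('a)} Basis"
    using bij_betw_from_nat_into_finite[of "Basis :: 'a set"] by auto
  define k where "k = DIM('a) - 1"
  have k: "Suc k = DIM('a)"
    by (simp add: k_def)
  have U: "{x::'a. norm x = 1 \<and> (\<forall>i. k < i \<and> i < DIM('a) \<longrightarrow> x \<bullet> e i = 0)} = sphere 0 1"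
    using k by auto
  have sep': "label_separated L \<delta> (sphere 0 1)"
    by (rule label_separated_subset[OF sep(1)]) auto
  from odd_alternating_chain_on_sphere[OF e L sep' sep(2), of k] k obtain c n
    where c: "singular_chain k (top_of_set (sphere 0 1)) c" "chain_boundary k (antipodal_diff k c) = 0"
    and n: "\<forall>m\<ge>n. odd (alternating_total L k ((singular_subdivision k ^^ m) c))"
    unfolding U by auto
  have "homotopic_with_canon (\<lambda>_. True) (sphere 0 1) (cball 0 1) id (\<lambda>_. 0 :: 'a)"
    by (rule homotopic_with_linear) (auto simp: closed_segment_subset)
  from filling_antipodal_diff[OF L sep' sep(2) _ c n this] obtain c' n'
    where c': "singular_chain (Suc k) (top_of_set (cball 0 1)) c'"
    and n': "\<forall>m\<ge>n'. odd (alternating_total L (Suc k) ((singular_subdivision (Suc k) ^^ m) c'))"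
    by (metis mem_sphere_0 norm_minus_cancel norm_zero zero_le_one mem_cball_0)
  obtain n1 where n1: "\<And>m f l. \<lbrakk>n1 \<le> m; f \<in> Poly_Mapping.keys ((singular_subdivision (Suc k) ^^ m) c');
      l \<in># vertex_labels L (Suc k) f\<rbrakk> \<Longrightarrow> antilabel l \<notin># vertex_labels L (Suc k) f"
    using fine_subdivision_labels[OF sep c'] by metis
  define d where "d = (singular_subdivision (Suc k) ^^ max n' n1) c'"
  have "alternating_count L True (Suc k) d \<noteq> 0 \<or> alternating_count L False (Suc k) d \<noteq> 0"
    using n'[rule_format, of "max n' n1"] by (auto simp: alternating_total_def d_def)
  then obtain s where "alternating_count L s (Suc k) d \<noteq> 0"
    by auto
  then obtain f where f: "f \<in> Poly_Mapping.keys d" "alternating_weight L s (Suc k) f \<noteq> 0"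
    unfolding alternating_count_def chain_weight_def by (metis (no_types, lifting) mult_zero_right sum.neutral)
  let ?M = "vertex_labels L (Suc k) f"
  have "card ((\<lambda>l. l div 2) ` set_mset ?M) = size ?M"
    using f n1[of "max n' n1" f] by (intro card_moduli_alternating[of _ s]) (auto simp: alternating_weight_def d_def)
  also have "size ?M = Suc (Suc k)"
    by (simp add: vertex_labels_def)
  finally have "card ((\<lambda>l. l div 2) ` set_mset ?M) = Suc (DIM('a))"
    using k by simp
  moreover have "simplicial_vertex i f \<in> cball 0 1" if "i \<le> Suc k" for i
    using simplicial_vertex_in_topspace[OF singular_chain_subdivision_power[OF c'], of f "max n' n1" i] f that
    by (simp add: d_def)
  then have "(\<lambda>l. l div 2) ` set_mset ?M \<subseteq> (\<lambda>x. L x div 2) ` cball 0 1"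
    by (auto simp: vertex_labels_def)
  ultimately show ?thesis
    using card_mono[OF fin] by (metis Suc_le_lessD)
qed

section \<open>Covers of the ball that are antipodal on the sphere\<close>

definition label_code :: "int \<Rightarrow> nat" where
  "label_code j = nat (2 * \<bar>j\<bar>) + (if j < 0 then 1 else 0)"

lemma label_code_uminus: "j \<noteq> 0 \<Longrightarrow> label_code (- j) = antilabel (label_code j)"
  by (auto simp: label_code_def antilabel_def nat_mult_distrib)

lemma label_code_div_2 [simp]: "label_code j div 2 = nat \<bar>j\<bar>"
  by (auto simp: label_code_def nat_mult_distrib)

lemma label_code_inject: "label_code i = label_code j \<longleftrightarrow> i = j"
proof
  assume eq: "label_code i = label_code j"
  then have "nat \<bar>i\<bar> = nat \<bar>j\<bar>"
    by (metis label_code_div_2)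
  with eq show "i = j"
    by (auto simp: label_code_def split: if_splits)
qed simp

lemma finite_signed_indices: "finite (signed_indices n)"
  by (rule finite_subset[of _ "{- int n..int n}"]) (auto simp: signed_indices_def)

lemma uminus_signed_indices [simp]: "- j \<in> signed_indices n \<longleftrightarrow> j \<in> signed_indices n"
  by (simp add: signed_indices_def)

lemma signed_disjointI:
  assumes "\<forall>i\<in>{1..n}. F (int i) \<inter> F (- int i) = {}" "j \<in> signed_indices n"
  shows "F j \<inter> F (- j) = {}"
proof (cases "0 < j")
  case True
  with assms(2) have "nat j \<in> {1..n}"
    by (auto simp: signed_indices_def)
  with assms(1) True show ?thesis
    by (metis int_nat_eq less_imp_le)
next
  case False
  with assms(2) have "nat (- j) \<in> {1..n}"
    by (auto simp: signed_indices_def)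
  with assms(1) False show ?thesis
    by (metis add.inverse_inverse inf_commute int_nat_eq linorder_not_less neg_0_le_iff_le)
qed

lemma uniform_separation:
  fixes A C :: "'i \<Rightarrow> 'a::euclidean_space set"
  assumes "finite I" and "\<And>j. j \<in> I \<Longrightarrow> compact (A j)" "\<And>j. j \<in> I \<Longrightarrow> closed (C j)"
    "\<And>j. j \<in> I \<Longrightarrow> A j \<inter> C j = {}"
  obtains \<delta> where "\<delta> > 0" "\<And>j x y. \<lbrakk>j \<in> I; x \<in> A j; y \<in> C j\<rbrakk> \<Longrightarrow> \<delta> \<le> dist x y"
proof -
  have "\<forall>j\<in>I. \<exists>\<delta>>0. \<forall>x\<in>A j. \<forall>y\<in>C j. \<delta> \<le> dist x y"
    using assms separate_compact_closed by metis
  then obtain d where d: "\<And>j. j \<in> I \<Longrightarrow> d j > 0"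
      "\<And>j x y. \<lbrakk>j \<in> I; x \<in> A j; y \<in> C j\<rbrakk> \<Longrightarrow> d j \<le> dist x y"
    by metis
  \<comment> \<open>the extra 1 covers an empty index set\<close>
  define \<delta> :: real where "\<delta> = Min (insert 1 (d ` I))"
  have "\<delta> > 0"
    using d(1) \<open>finite I\<close> by (auto simp: \<delta>_def)
  moreover have "\<delta> \<le> d j" if "j \<in> I" for j
    using that \<open>finite I\<close> by (auto simp: \<delta>_def)
  ultimately show thesis
    using that d(2) by (meson order_trans)
qed

text \<open>If opposite sets were disjoint, labelling each point by a set that contains it would give a labelling
  with separated opposite labels and only \<open>n\<close> moduli.\<close>

lemma antipodal_cover_meets:
  fixes G :: "int \<Rightarrow> 'a::euclidean_space set"
  assumes n: "n \<le> DIM('a)"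
    and G: "\<And>j. j \<in> signed_indices n \<Longrightarrow> compact (G j)" "cball 0 1 \<subseteq> (\<Union>j\<in>signed_indices n. G j)"
    and odd: "\<And>j x. \<lbrakk>j \<in> signed_indices n; x \<in> G j; norm x = 1\<rbrakk> \<Longrightarrow> - x \<in> G (- j)"
  shows "\<exists>i\<in>{1..n}. G (int i) \<inter> G (- int i) \<noteq> {}"
proof (rule ccontr)
  assume "\<not> ?thesis"
  then have disj: "G j \<inter> G (- j) = {}" if "j \<in> signed_indices n" for j
    using signed_disjointI[of n G] that by blast
  obtain \<delta> where \<delta>: "\<delta> > 0"
    "\<And>j x y. \<lbrakk>j \<in> signed_indices n; x \<in> G j; y \<in> G (- j)\<rbrakk> \<Longrightarrow> \<delta> \<le> dist x y"
    using uniform_separation[of "signed_indices n" G "\<lambda>j. G (- j)"] G(1) disj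
      finite_signed_indices[of n] by (metis compact_imp_closed uminus_signed_indices)
  obtain g where g: "\<And>x. norm x \<le> 1 \<Longrightarrow> g x \<in> signed_indices n \<and> x \<in> G (g x)"
    using G(2) by (metis UN_E mem_cball_0 subsetD)
  \<comment> \<open>a choice of one point from every antipodal pair, which makes
    the labelling odd on the sphere\<close>
  define rep :: "'a \<Rightarrow> 'a" where "rep x = (SOME y. y \<in> {x, - x})" for x
  have rep: "rep x = x \<or> rep x = - x" for x
    using someI[of "\<lambda>y. y \<in> {x, - x}" x] by (auto simp: rep_def)
  have rep_minus: "rep (- x) = rep x" for x
    by (simp add: rep_def insert_commute)
  define l where "l x = (if norm x = 1 \<and> rep x \<noteq> x then - g (- x) else g x)" for x
  have l: "l x \<in> signed_indices n \<and> x \<in> G (l x)" if "norm x \<le> 1" for x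
    using g[of x] g[of "- x"] odd[of "g (- x)" "- x"] that by (auto simp: l_def)
  have l_minus: "l (- x) = - l x" if "norm x = 1" for x
  proof -
    have "x \<noteq> - x"
      using that by (auto simp: eq_neg_iff_add_eq_0 simp flip: scaleR_2)
    then show ?thesis
      using that rep[of x] rep_minus[of x] by (auto simp: l_def)
  qed
  have nz: "l x \<noteq> 0" if "norm x \<le> 1" for x
    using l[OF that] by (auto simp: signed_indices_def)
  define L where "L x = label_code (l x)" for x
  have moduli: "(\<lambda>x. L x div 2) ` cball 0 1 \<subseteq> {1..n}"
    using l by (fastforce simp: L_def signed_indices_def)
  have "DIM('a) < card ((\<lambda>x. L x div 2) ` cball 0 1)"
  proof (rule card_moduli_antipodal_labelling)
    show "L (- x) = antilabel (L x)" if "x \<in> sphere 0 1" for x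
      using that nz[of x] by (simp add: L_def l_minus label_code_uminus)
    show "label_separated L \<delta> (cball 0 1)"
      unfolding label_separated_def
    proof (intro ballI impI notI)
      fix x y :: 'a
      assume x: "x \<in> cball 0 1" and y: "y \<in> cball 0 1" and "dist x y < \<delta>"
        and "L y = antilabel (L x)"
      then have "l y = - l x"
        using nz[of x] by (simp add: L_def label_code_inject flip: label_code_uminus)
      with \<delta>(2)[of "l x" x y] l[of x] l[of y] x y \<open>dist x y < \<delta>\<close> show False
        by auto
    qed
    show "finite ((\<lambda>x. L x div 2) ` cball 0 1)"
      using finite_subset[OF moduli] by simp
  qed (rule \<delta>(1))
  also have "\<dots> \<le> n"
    using card_mono[OF _ moduli] by simp
  finally show False
    using n by simp
qed

text \<open>A closed cover consists of compact sets already. For an open cover, a Lebesgue number \<open>\<delta>\<close> allows to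
  discard all points closer than \<open>\<delta>\<close> to the complement of a set. This treats open and closed covers
  alike from here on.\<close>

lemma compact_shrinking:
  fixes F :: "'i \<Rightarrow> 'a::euclidean_space set"
  assumes F: "is_cover (top_of_set B) I F" and B: "compact B"
  obtains G where "\<And>j. j \<in> I \<Longrightarrow> compact (G j)" "\<And>j. j \<in> I \<Longrightarrow> G j \<subseteq> F j" "B \<subseteq> (\<Union>j\<in>I. G j)"
proof (cases "\<forall>j\<in>I. closedin (top_of_set B) (F j)")
  case True
  then show thesis
    using F B closedin_compact by (intro that[of F]) (auto simp: is_cover_def)
next
  case False
  with F have "\<forall>j\<in>I. \<exists>W. open W \<and> F j = B \<inter> W"
    by (auto simp: is_cover_def openin_open)
  then obtain W where W: "\<And>j. j \<in> I \<Longrightarrow> open (W j)" "\<And>j. j \<in> I \<Longrightarrow> F j = B \<inter> W j"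
    by metis
  have "B \<subseteq> \<Union> (W ` I)"
    using F W(2) by (auto simp: is_cover_def)
  then obtain \<delta> where "\<delta> > 0" and \<delta>: "\<And>x. x \<in> B \<Longrightarrow> \<exists>V\<in>W ` I. ball x \<delta> \<subseteq> V"
    using Heine_Borel_lemma[OF B, of "W ` I"] W(1) by (metis imageE)
  define G where "G j = B - (\<Union>y\<in>B - F j. ball y \<delta>)" for j
  show thesis
  proof
    show "compact (G j)" for j
      unfolding G_def by (intro compact_diff B open_UN ballI open_ball)
    show "G j \<subseteq> F j" for j
      using \<open>\<delta> > 0\<close> by (auto simp: G_def)
    show "B \<subseteq> (\<Union>j\<in>I. G j)"
    proof
      fix x assume "x \<in> B"
      with \<delta> obtain j where j: "j \<in> I" "ball x \<delta> \<subseteq> W j"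
        by auto
      have "y \<in> F j" if "y \<in> B" "x \<in> ball y \<delta>" for y
        using j that W(2) by (auto simp: dist_commute)
      then have "x \<in> G j"
        using \<open>x \<in> B\<close> by (auto simp: G_def)
      with j(1) show "x \<in> (\<Union>j\<in>I. G j)"
        by blast
    qed
  qed
qed

text \<open>Shrinking may destroy the antipodal symmetry on the sphere. It is restored by adding to each compact
  set the antipodes of the spherical part of the opposite one, which stay inside the given
  set because the given cover is symmetric there.\<close>

lemma antipodal_on_sphere_cover_meets:
  fixes F :: "int \<Rightarrow> 'a::euclidean_space set"
  assumes n: "n \<le> DIM('a)" and F: "is_cover (top_of_set (cball 0 1)) (signed_indices n) F"
    and odd: "antipodal_on_sphere n F"
  shows "\<exists>i\<in>{1..n}. F (int i) \<inter> F (- int i) \<noteq> {}"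
proof -
  obtain G where G: "\<And>j. j \<in> signed_indices n \<Longrightarrow> compact (G j)"
    "\<And>j. j \<in> signed_indices n \<Longrightarrow> G j \<subseteq> F j" "cball 0 1 \<subseteq> (\<Union>j\<in>signed_indices n. G j)"
    using compact_shrinking[OF F compact_cball] by metis
  define H where "H j = G j \<union> uminus ` (G (- j) \<inter> sphere 0 1)" for j
  have "\<exists>i\<in>{1..n}. H (int i) \<inter> H (- int i) \<noteq> {}"
  proof (rule antipodal_cover_meets[OF n])
    show "compact (H j)" if "j \<in> signed_indices n" for j
      unfolding H_def using that
      by (intro compact_Un G compact_negations compact_Int compact_sphere) auto
    show "cball 0 1 \<subseteq> (\<Union>j\<in>signed_indices n. H j)"
      using G(3) by (auto simp: H_def)
    show "- x \<in> H (- j)" if "j \<in> signed_indices n" "x \<in> H j" "norm x = 1" for j x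
      using that by (auto simp: H_def)
  qed
  moreover have "H j \<subseteq> F j" if "j \<in> signed_indices n" for j
  proof -
    have "F j \<inter> sphere 0 1 = uminus ` (F (- j) \<inter> sphere 0 1)"
      using odd that unfolding antipodal_on_sphere_def
      by (metis add.inverse_inverse uminus_signed_indices)
    then show ?thesis
      using G(2)[of j] G(2)[of "- j"] that unfolding H_def by auto
  qed
  moreover have "int i \<in> signed_indices n \<and> - int i \<in> signed_indices n" if "i \<in> {1..n}" for i
    using that by (auto simp: signed_indices_def)
  ultimately show ?thesis
    by blast
qed

section \<open>Signed vectors and balanced sets\<close>

lemma signed_vector_uminus: "j \<noteq> 0 \<Longrightarrow> signed_vector e (- j) = - signed_vector e j"
  by (auto simp: signed_vector_def)

text \<open>A set of indices without an opposite pair selects for each basis vector at most one sign, so its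
  vectors lie in a hyperplane off the origin. Both nonvanishing of weighted sums and the
  description of balanced sets rest on this.\<close>

lemma signed_functional:
  fixes e :: "nat \<Rightarrow> 'a::real_vector"
  assumes e: "inj_on e {1..n}" "independent (e ` {1..n})"
    and B: "B \<subseteq> signed_indices n" "\<And>j. j \<in> B \<Longrightarrow> - j \<notin> B"
  obtains f :: "'a \<Rightarrow> real" where "linear f" "\<And>j. j \<in> B \<Longrightarrow> f (signed_vector e j) = 1"
proof -
  obtain f :: "'a \<Rightarrow> real" where f: "linear f"
    "\<forall>w\<in>e ` {1..n}. f w = (if int (inv_into {1..n} e w) \<in> B then 1 else - 1)"
    using linear_independent_extend[OF e(2),
      of "\<lambda>w. if int (inv_into {1..n} e w) \<in> B then 1 else - 1 :: real"] by auto
  then have fe: "f (e i) = (if int i \<in> B then 1 else - 1)" if "i \<in> {1..n}" for i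
    using that e(1) by simp
  have "f (signed_vector e j) = 1" if "j \<in> B" for j
  proof -
    have "j \<in> signed_indices n"
      using that B(1) by blast
    then have j: "0 < j \<and> nat j \<in> {1..n} \<or> j < 0 \<and> nat (- j) \<in> {1..n}"
      by (auto simp: signed_indices_def)
    have neg: "f (- w) = - f w" for w
      using f(1) by (rule linear_neg)
    have "- j \<notin> B"
      using that by (rule B(2))
    with that j show ?thesis
      using fe[of "nat j"] fe[of "nat (- j)"] by (auto simp: signed_vector_def neg)
  qed
  with f(1) that show thesis
    by blast
qed

lemma signed_sum_nonzero:
  fixes e :: "nat \<Rightarrow> 'a::real_vector"
  assumes e: "inj_on e {1..n}" "independent (e ` {1..n})"
    and a: "(\<Sum>j\<in>signed_indices n. a j) = 1"
    and pair: "\<And>j. \<lbrakk>j \<in> signed_indices n; a j \<noteq> 0\<rbrakk> \<Longrightarrow> a (- j) = 0"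
  shows "(\<Sum>j\<in>signed_indices n. a j *\<^sub>R signed_vector e j) \<noteq> 0"
proof
  let ?I = "signed_indices n"
  assume 0: "(\<Sum>j\<in>?I. a j *\<^sub>R signed_vector e j) = 0"
  obtain f :: "'a \<Rightarrow> real" where f: "linear f"
    "\<And>j. j \<in> {j \<in> ?I. a j \<noteq> 0} \<Longrightarrow> f (signed_vector e j) = 1"
    using signed_functional[OF e, of "{j \<in> ?I. a j \<noteq> 0}"] pair by auto
  have "0 = f (\<Sum>j\<in>?I. a j *\<^sub>R signed_vector e j)"
    using f(1) 0 by (simp add: linear_0)
  also have "\<dots> = (\<Sum>j\<in>?I. a j * f (signed_vector e j))"
    using f(1) by (simp add: linear_sum linear_cmul)
  also have "\<dots> = (\<Sum>j\<in>?I. a j)"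
    using f(2) by (intro sum.cong) auto
  finally show False
    using a by simp
qed

lemma balanced_free_signed_iff:
  fixes e :: "nat \<Rightarrow> 'a::real_vector"
  assumes e: "inj_on e {1..n}" "independent (e ` {1..n})"
  shows "balanced_free (signed_indices n) (signed_vector e) U
     \<longleftrightarrow> (\<forall>j\<in>signed_indices n. U j \<inter> U (- j) = {})"
proof
  assume bf: "balanced_free (signed_indices n) (signed_vector e) U"
  show "\<forall>j\<in>signed_indices n. U j \<inter> U (- j) = {}"
  proof
    fix j assume j: "j \<in> signed_indices n"
    then have "j \<noteq> 0"
      by (auto simp: signed_indices_def)
    have "(1 / 2) *\<^sub>R signed_vector e j + (1 / 2) *\<^sub>R signed_vector e (- j)
        \<in> convex hull (signed_vector e ` {j, - j})"
      by (rule convexD[OF convex_convex_hull]) (simp_all add: hull_inc)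
    moreover have "(1 / 2) *\<^sub>R signed_vector e j + (1 / 2) *\<^sub>R signed_vector e (- j) = 0"
      using \<open>j \<noteq> 0\<close> by (simp add: signed_vector_uminus)
    ultimately have "balanced (signed_indices n) (signed_vector e) {j, - j}"
      using j by (simp only: balanced_def) simp
    with bf show "U j \<inter> U (- j) = {}"
      by (auto simp: balanced_free_def)
  qed
next
  assume disj: "\<forall>j\<in>signed_indices n. U j \<inter> U (- j) = {}"
  show "balanced_free (signed_indices n) (signed_vector e) U"
    unfolding balanced_free_def
  proof (intro allI impI)
    fix B assume B: "balanced (signed_indices n) (signed_vector e) B"
    have "\<exists>j\<in>B. - j \<in> B"
    proof (rule ccontr)
      assume "\<not> ?thesis"
      then obtain f :: "'a \<Rightarrow> real" where f: "linear f" "\<And>j. j \<in> B \<Longrightarrow> f (signed_vector e j) = 1"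
        using signed_functional[OF e, of B] B by (auto simp: balanced_def)
      have "f ` (convex hull (signed_vector e ` B)) = convex hull (f ` signed_vector e ` B)"
        using f(1) by (rule convex_hull_linear_image)
      also have "\<dots> \<subseteq> {1}"
        using f(2) by (intro hull_minimal) auto
      finally have "f 0 = 1"
        using B by (auto simp: balanced_def)
      then show False
        using f(1) by (simp add: linear_0)
    qed
    then obtain j where "j \<in> B" "- j \<in> B"
      by blast
    then have "(\<Inter>j\<in>B. U j) \<subseteq> U j \<inter> U (- j)" "j \<in> signed_indices n"
      using B by (auto simp: balanced_def)
    with disj show "(\<Inter>j\<in>B. U j) = {}"
      by blast
  qed
qed

section \<open>Homotopy classes of covers that extend over the ball\<close>

text \<open>The functions are normalised bumps \<open>max 0 (\<epsilon> - dist(x, G j))\<close>, supported in the \<open>\<epsilon>\<close>-neighbourhoods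
  \<open>K j\<close> of the compact sets. The closed sets \<open>C j\<close> are extra obstacles for the supports; they serve
  to keep the supports on the sphere inside a prescribed open cover.\<close>

lemma compact_cover_partition:
  fixes G C :: "int \<Rightarrow> 'b::euclidean_space set"
  assumes G: "\<forall>j\<in>signed_indices n. compact (G j)" "B \<subseteq> (\<Union>j\<in>signed_indices n. G j)"
    and disj: "\<forall>j\<in>signed_indices n. G j \<inter> G (- j) = {}"
    and C: "\<forall>j\<in>signed_indices n. closed (C j) \<and> G j \<inter> C j = {}"
  obtains \<psi> :: "int \<Rightarrow> 'b \<Rightarrow> real" and K where
    "\<forall>j\<in>signed_indices n. continuous_on B (\<psi> j) \<and> (\<forall>x\<in>B. 0 \<le> \<psi> j x)"
    "\<forall>x\<in>B. (\<Sum>j\<in>signed_indices n. \<psi> j x) = 1"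
    "\<forall>j\<in>signed_indices n. closed (K j) \<and> (\<forall>x\<in>B. \<psi> j x \<noteq> 0 \<longrightarrow> x \<in> K j)"
    "\<forall>j\<in>signed_indices n. K j \<inter> K (- j) = {} \<and> K j \<inter> C j = {}"
proof -
  let ?I = "signed_indices n"
  have "closed (G (- j) \<union> C j)" "G j \<inter> (G (- j) \<union> C j) = {}" if "j \<in> ?I" for j
  proof -
    have "closed (G (- j))"
      using that G(1) by (simp add: compact_imp_closed)
    then show "closed (G (- j) \<union> C j)" "G j \<inter> (G (- j) \<union> C j) = {}"
      using that C disj by auto
  qed
  then obtain \<delta> where "\<delta> > 0"
    and \<delta>: "\<And>j x y. \<lbrakk>j \<in> ?I; x \<in> G j; y \<in> G (- j) \<union> C j\<rbrakk> \<Longrightarrow> \<delta> \<le> dist x y"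
    using uniform_separation[of ?I G "\<lambda>j. G (- j) \<union> C j"] G(1) finite_signed_indices[of n] by metis
  \<comment> \<open>two \<open>\<epsilon>\<close>-neighbourhoods must stay apart, so \<open>2 * \<epsilon> < \<delta>\<close>\<close>
  define \<epsilon> where "\<epsilon> = \<delta> / 3"
  have "\<epsilon> > 0"
    using \<open>\<delta> > 0\<close> by (simp add: \<epsilon>_def)
  \<comment> \<open>\<open>infdist\<close> to the empty set is 0, so empty sets need the zero function\<close>
  define \<beta> where "\<beta> j x = (if G j = {} then 0 else max 0 (\<epsilon> - infdist x (G j)))" for j x
  define K where "K j = (if G j = {} then {} else {x. infdist x (G j) \<le> \<epsilon>})" for j
  define \<psi> where "\<psi> j x = \<beta> j x / (\<Sum>i\<in>?I. \<beta> i x)" for j x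
  have cont: "continuous_on B (\<beta> j)" for j
    unfolding \<beta>_def by (cases "G j = {}") (simp_all add: continuous_intros)
  have nonneg: "0 \<le> \<beta> j x" for j x
    by (simp add: \<beta>_def)
  have pos: "0 < (\<Sum>i\<in>?I. \<beta> i x)" if x: "x \<in> B" for x
  proof -
    obtain j where "j \<in> ?I" "x \<in> G j"
      using G(2) x by blast
    then have "0 < \<beta> j x"
      using \<open>\<epsilon> > 0\<close> by (auto simp: \<beta>_def)
    then show ?thesis
      using \<open>j \<in> ?I\<close> nonneg by (intro sum_pos2[OF finite_signed_indices, of j]) auto
  qed
  have near: "\<exists>y\<in>G j. dist x y \<le> \<epsilon>" if "j \<in> ?I" "x \<in> K j" for x j
  proof -
    have "G j \<noteq> {}" "infdist x (G j) \<le> \<epsilon>"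
      using that(2) by (auto simp: K_def split: if_splits)
    moreover have "closed (G j)"
      using G(1) that(1) compact_imp_closed by blast
    ultimately show ?thesis
      using infdist_attains_inf[of "G j" x] by metis
  qed
  show thesis
  proof (rule that[of \<psi> K]; intro ballI conjI impI)
    show "continuous_on B (\<psi> j)" for j
      unfolding \<psi>_def
      by (intro continuous_on_divide continuous_on_sum cont ballI) (metis pos less_irrefl)
    show "0 \<le> \<psi> j x" for j x
      by (simp add: \<psi>_def nonneg sum_nonneg)
    show "(\<Sum>j\<in>?I. \<psi> j x) = 1" if "x \<in> B" for x
      using pos[OF that] by (simp add: \<psi>_def flip: sum_divide_distrib)
    show "closed (K j)" for j
      using closed_Collect_le[of "\<lambda>x. infdist x (G j)" "\<lambda>_. \<epsilon>"] by (simp add: K_def continuous_intros)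
    show "x \<in> K j" if "\<psi> j x \<noteq> 0" for j x
    proof -
      have "\<beta> j x \<noteq> 0"
        using that by (auto simp: \<psi>_def)
      then show ?thesis
        by (auto simp: \<beta>_def K_def split: if_splits)
    qed
    show "K j \<inter> K (- j) = {}" if j: "j \<in> ?I" for j
    proof (rule ccontr)
      assume "K j \<inter> K (- j) \<noteq> {}"
      then obtain x where "x \<in> K j" "x \<in> K (- j)"
        by blast
      then obtain y z where y: "y \<in> G j" "dist x y \<le> \<epsilon>" and z: "z \<in> G (- j)" "dist x z \<le> \<epsilon>"
        using near[of j x] near[of "- j" x] j by auto
      have "dist y z \<le> 2 * \<epsilon>"
        using y(2) z(2) dist_triangle3[of y z x] by simp
      moreover have "\<delta> \<le> dist y z"
        using \<delta>[OF j, of y z] y(1) z(1) by simp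
      ultimately have "\<delta> \<le> 2 * \<epsilon>"
        by simp
      with \<open>\<delta> > 0\<close> show False
        by (simp add: \<epsilon>_def)
    qed
    show "K j \<inter> C j = {}" if j: "j \<in> ?I" for j
    proof (rule ccontr)
      assume "K j \<inter> C j \<noteq> {}"
      then obtain x y where "x \<in> C j" "y \<in> G j" "dist x y \<le> \<epsilon>"
        using near[OF j] by blast
      with \<delta>[OF j, of y x] \<open>\<delta> > 0\<close> show False
        by (simp add: \<epsilon>_def dist_commute)
    qed
  qed
qed

text \<open>A partition of unity on the whole ball yields a map of the ball into the unit sphere of the target,
  so its restriction \<open>\<rho> \<psi>\<close> to the sphere is null-homotopic. The partition \<open>\<phi>\<close> that represents the
  class of \<open>U\<close> is unrelated to \<open>\<psi>\<close>, but both are subordinate to the balanced-free cover \<open>U\<close>,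
  so the segment from \<open>\<rho> \<phi>\<close> to \<open>\<rho> \<psi>\<close> avoids the origin.\<close>

lemma open_cover_class_null:
  fixes e :: "nat \<Rightarrow> 'a::euclidean_space" and G U :: "int \<Rightarrow> 'b::euclidean_space set"
  assumes e: "inj_on e {1..n}" "independent (e ` {1..n})"
    and G: "\<And>j. j \<in> signed_indices n \<Longrightarrow> compact (G j)" "cball 0 1 \<subseteq> (\<Union>j\<in>signed_indices n. G j)"
    and disj: "\<And>j. j \<in> signed_indices n \<Longrightarrow> G j \<inter> G (- j) = {}"
    and U: "\<And>j. j \<in> signed_indices n \<Longrightarrow> openin (top_of_set (sphere 0 1)) (U j)"
      "\<And>j. j \<in> signed_indices n \<Longrightarrow> G j \<inter> sphere 0 1 \<subseteq> U j"
      "balanced_free (signed_indices n) (signed_vector e) U"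
  shows "null_class (top_of_set (sphere 0 1)) (top_of_set (sphere 0 1))
    (open_cover_class (top_of_set (sphere 0 1)) (signed_indices n) (signed_vector e) U)"
proof -
  let ?I = "signed_indices n" and ?v = "signed_vector e"
  let ?S = "sphere (0::'b) 1" and ?B = "cball (0::'b) 1"
  define \<rho> where "\<rho> a x = (\<Sum>j\<in>?I. a j x *\<^sub>R ?v j)" for a :: "int \<Rightarrow> 'b \<Rightarrow> real" and x
  define N where "N y = y /\<^sub>R norm y" for y :: 'a
  have cover_map: "cover_map ?I ?v a = N \<circ> \<rho> a" for a
    by (simp add: fun_eq_iff cover_map_def \<rho>_def N_def)
  have C: "\<forall>j\<in>?I. closed (?S - U j) \<and> G j \<inter> (?S - U j) = {}"
  proof (intro ballI conjI)
    fix j assume j: "j \<in> ?I"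
    show "closed (?S - U j)"
      using closedin_diff[OF closedin_topspace U(1)[OF j]] closedin_closed_trans[OF _ closed_sphere]
      by simp
    show "G j \<inter> (?S - U j) = {}"
      using U(2)[OF j] by blast
  qed
  obtain \<psi> :: "int \<Rightarrow> 'b \<Rightarrow> real" and K where *:
    "\<forall>j\<in>?I. continuous_on ?B (\<psi> j) \<and> (\<forall>x\<in>?B. 0 \<le> \<psi> j x)"
    "\<forall>x\<in>?B. (\<Sum>j\<in>?I. \<psi> j x) = 1"
    "\<forall>j\<in>?I. closed (K j) \<and> (\<forall>x\<in>?B. \<psi> j x \<noteq> 0 \<longrightarrow> x \<in> K j)"
    "\<forall>j\<in>?I. K j \<inter> K (- j) = {} \<and> K j \<inter> (?S - U j) = {}"
    by (rule compact_cover_partition[OF _ G(2) _ C]) (use G(1) disj in \<open>auto intro: that\<close>)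
  from * have \<psi>: "\<And>j. j \<in> ?I \<Longrightarrow> continuous_on ?B (\<psi> j)"
    "\<And>j x. \<lbrakk>j \<in> ?I; x \<in> ?B\<rbrakk> \<Longrightarrow> 0 \<le> \<psi> j x" "\<And>x. x \<in> ?B \<Longrightarrow> (\<Sum>j\<in>?I. \<psi> j x) = 1"
    and K: "\<And>j. j \<in> ?I \<Longrightarrow> closed (K j)"
    "\<And>j x. \<lbrakk>j \<in> ?I; x \<in> ?B; \<psi> j x \<noteq> 0\<rbrakk> \<Longrightarrow> x \<in> K j"
    "\<And>j. j \<in> ?I \<Longrightarrow> K j \<inter> K (- j) = {}" "\<And>j. j \<in> ?I \<Longrightarrow> K j \<inter> (?S - U j) = {}"
    by blast+
  have "partition_of_unity (top_of_set ?S) ?I U \<psi>"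
    unfolding partition_of_unity_def
  proof (intro conjI ballI)
    fix j assume j: "j \<in> ?I"
    show "continuous_map (top_of_set ?S) euclideanreal (\<psi> j)"
      using continuous_on_subset[OF \<psi>(1)[OF j]] by auto
    have "top_of_set ?S closure_of {x \<in> topspace (top_of_set ?S). \<psi> j x \<noteq> 0} \<subseteq> ?S \<inter> K j"
      using K(1,2)[OF j] by (intro closure_of_minimal) (auto intro: closedin_closed_Int)
    also have "\<dots> \<subseteq> U j"
      using K(4)[OF j] by blast
    finally show "top_of_set ?S closure_of {x \<in> topspace (top_of_set ?S). \<psi> j x \<noteq> 0} \<subseteq> U j" .
  qed (use \<psi> in auto)
  then have "partition_of_unity (top_of_set ?S) ?I U (SOME \<phi>. partition_of_unity (top_of_set ?S) ?I U \<phi>)"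
    by (rule someI[where P = "partition_of_unity (top_of_set ?S) ?I U"])
  then obtain \<phi> where some: "\<phi> = (SOME \<phi>. partition_of_unity (top_of_set ?S) ?I U \<phi>)"
    and \<phi>: "partition_of_unity (top_of_set ?S) ?I U \<phi>"
    by blast
  have \<phi>_cont: "continuous_on ?S (\<phi> j)" if "j \<in> ?I" for j
    using \<phi> that by (auto simp: partition_of_unity_def)
  have \<phi>_nonneg: "0 \<le> \<phi> j x" if "j \<in> ?I" "x \<in> ?S" for j x
    using \<phi> that by (auto simp: partition_of_unity_def)
  have \<phi>_sum: "(\<Sum>j\<in>?I. \<phi> j x) = 1" if "x \<in> ?S" for x
    using \<phi> that by (auto simp: partition_of_unity_def)
  have \<phi>_supp: "x \<in> U j" if "j \<in> ?I" "x \<in> ?S" "\<phi> j x \<noteq> 0" for j x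
  proof -
    have "x \<in> top_of_set ?S closure_of {x \<in> topspace (top_of_set ?S). \<phi> j x \<noteq> 0}"
      by (rule subsetD[OF closure_of_subset]) (use that in auto)
    with \<phi> that(1) show ?thesis
      by (auto simp: partition_of_unity_def)
  qed
  have \<psi>_supp: "x \<in> U j" if "j \<in> ?I" "x \<in> ?S" "\<psi> j x \<noteq> 0" for j x
    using K(2)[of j x] K(4)[of j] that by auto
  have U_disj: "U j \<inter> U (- j) = {}" if "j \<in> ?I" for j
    using U(3) that by (simp add: balanced_free_signed_iff[OF e])
  have \<rho>\<psi>: "continuous_on ?B (\<rho> \<psi>)" "\<rho> \<psi> \<in> ?B \<rightarrow> - {0}"
  proof -
    show "continuous_on ?B (\<rho> \<psi>)"
      unfolding \<rho>_def by (intro continuous_intros \<psi>(1))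
    show "\<rho> \<psi> \<in> ?B \<rightarrow> - {0}"
    proof (rule Pi_I)
      fix x assume "x \<in> ?B"
      then have "\<rho> \<psi> x \<noteq> 0"
        unfolding \<rho>_def using \<psi>(3) K(2,3)
        by (intro signed_sum_nonzero[OF e]) (auto, metis disjoint_iff mem_cball_0 uminus_signed_indices)
      then show "\<rho> \<psi> x \<in> - {0}"
        by simp
    qed
  qed
  have "homotopic_with_canon (\<lambda>_. True) ?S (- {0}) (\<rho> \<phi>) (\<rho> \<psi>)"
  proof (rule homotopic_with_linear)
    show "continuous_on ?S (\<rho> \<phi>)"
      unfolding \<rho>_def by (intro continuous_intros \<phi>_cont)
    show "continuous_on ?S (\<rho> \<psi>)"
      using \<rho>\<psi>(1) by (rule continuous_on_subset) auto
    show "closed_segment (\<rho> \<phi> x) (\<rho> \<psi> x) \<subseteq> - {0}" if x: "x \<in> ?S" for x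
    proof
      fix y assume "y \<in> closed_segment (\<rho> \<phi> x) (\<rho> \<psi> x)"
      then obtain t where y: "y = (1 - t) *\<^sub>R \<rho> \<phi> x + t *\<^sub>R \<rho> \<psi> x"
        by (auto simp: in_segment)
      define a where "a j = (1 - t) * \<phi> j x + t * \<psi> j x" for j
      have "y = (\<Sum>j\<in>?I. a j *\<^sub>R ?v j)"
        by (simp add: y \<rho>_def a_def scaleR_sum_right scaleR_left_distrib sum.distrib)
      moreover have "\<dots> \<noteq> 0"
      proof (rule signed_sum_nonzero[OF e])
        show "sum a ?I = 1"
          using x \<phi>_sum[OF x] \<psi>(3)[of x] by (simp add: a_def sum.distrib flip: sum_distrib_left)
        have "x \<in> U j" if "j \<in> ?I" "a j \<noteq> 0" for j
          using \<phi>_supp[OF that(1) x] \<psi>_supp[OF that(1) x] that(2)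
          by (cases "\<phi> j x = 0"; cases "\<psi> j x = 0") (auto simp: a_def)
        then show "a (- j) = 0" if "j \<in> ?I" "a j \<noteq> 0" for j
          using U_disj that by (metis disjoint_iff uminus_signed_indices)
      qed
      ultimately show "y \<in> - {0}"
        by simp
    qed
  qed
  moreover have N: "continuous_on (- {0}) N" "N \<in> - {0} \<rightarrow> sphere 0 1"
    by (auto simp: N_def intro!: continuous_intros)
  ultimately have 1: "homotopic_with_canon (\<lambda>_. True) ?S (sphere 0 1) (N \<circ> \<rho> \<phi>) (N \<circ> \<rho> \<psi>)"
    by (rule homotopic_with_compose_continuous_left)
  have "homotopic_with_canon (\<lambda>_. True) ?S ?B id (\<lambda>_. 0)"
    by (rule homotopic_with_linear) (auto simp: closed_segment_subset)
  moreover have N\<rho>: "continuous_on ?B (N \<circ> \<rho> \<psi>)" "N \<circ> \<rho> \<psi> \<in> ?B \<rightarrow> sphere 0 1"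
  proof -
    have "\<rho> \<psi> ` ?B \<subseteq> - {0}"
      using \<rho>\<psi>(2) by (rule funcset_image)
    then show "continuous_on ?B (N \<circ> \<rho> \<psi>)"
      by (intro continuous_on_compose \<rho>\<psi>(1) continuous_on_subset[OF N(1)])
    show "N \<circ> \<rho> \<psi> \<in> ?B \<rightarrow> sphere 0 1"
      using \<rho>\<psi>(2) N(2) by (auto simp: Pi_iff)
  qed
  ultimately have "homotopic_with_canon (\<lambda>_. True) ?S (sphere 0 1)
      ((N \<circ> \<rho> \<psi>) \<circ> id) ((N \<circ> \<rho> \<psi>) \<circ> (\<lambda>_. 0))"
    by (rule homotopic_with_compose_continuous_left)
  with 1 have hom: "homotopic_with_canon (\<lambda>_. True) ?S (sphere 0 1) (cover_map ?I ?v \<phi>) (\<lambda>_. N (\<rho> \<psi> 0))"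
    unfolding cover_map comp_id by (auto simp: comp_def intro: homotopic_with_trans)
  have "homotopy_class (top_of_set ?S) (top_of_set (sphere 0 1)) (cover_map ?I ?v \<phi>)
      = homotopy_class (top_of_set ?S) (top_of_set (sphere 0 1)) (\<lambda>_. N (\<rho> \<psi> 0))"
    unfolding homotopy_class_def
    using homotopic_with_trans[OF hom] homotopic_with_trans[OF homotopic_with_symD[OF hom]]
    by (intro Collect_cong iffI)
  moreover have "N (\<rho> \<psi> 0) \<in> sphere 0 1"
    using N\<rho>(2) by auto
  ultimately show ?thesis
    unfolding null_class_def open_cover_class_def some by auto
qed

text \<open>If opposite sets were disjoint, the class of the boundary cover would be null by
  \<open>open_cover_class_null\<close>. The cover \<open>U\<close> there is the boundary cover itself if it is
  open, and an arbitrary open enlargement of it otherwise; in the second case the given cover is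
  closed and thin neighbourhoods show that an enlargement exists.\<close>

lemma not_null_homotopic_cover_meets:
  fixes e :: "nat \<Rightarrow> 'a::euclidean_space" and F :: "int \<Rightarrow> 'b::euclidean_space set"
  assumes e: "inj_on e {1..n}" "independent (e ` {1..n})"
    and F: "is_cover (top_of_set (cball 0 1)) (signed_indices n) F"
    and S: "not_null_homotopic_cover (top_of_set (sphere 0 1)) (signed_indices n) (signed_vector e)
            (\<lambda>j. F j \<inter> sphere 0 1)"
  shows "\<exists>i\<in>{1..n}. F (int i) \<inter> F (- int i) \<noteq> {}"
proof (rule ccontr)
  let ?I = "signed_indices n" and ?v = "signed_vector e" and ?T = "top_of_set (sphere (0::'b) 1)"
  let ?S = "\<lambda>j. F j \<inter> sphere 0 1"
  assume "\<not> ?thesis"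
  then have F_disj: "F j \<inter> F (- j) = {}" if "j \<in> ?I" for j
    using signed_disjointI[of n F] that by blast
  obtain G where G: "\<And>j. j \<in> ?I \<Longrightarrow> compact (G j)" "\<And>j. j \<in> ?I \<Longrightarrow> G j \<subseteq> F j"
      "cball 0 1 \<subseteq> (\<Union>j\<in>?I. G j)"
    using compact_shrinking[OF F compact_cball] by metis
  have G_disj: "G j \<inter> G (- j) = {}" if "j \<in> ?I" for j
    using F_disj[OF that] G(2)[of j] G(2)[of "- j"] that by auto
  note null = open_cover_class_null[OF e G(1,3) G_disj]
  have "null_class ?T (top_of_set (sphere 0 1)) (cover_class ?T ?I ?v ?S)"
  proof (cases "\<forall>j\<in>?I. openin ?T (?S j)")
    case True
    have "null_class ?T (top_of_set (sphere 0 1)) (open_cover_class ?T ?I ?v ?S)"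
      by (rule null) (use True G(2) S in \<open>auto simp: not_null_homotopic_cover_def\<close>)
    with True show ?thesis
      by (simp add: cover_class_def)
  next
    case False
    have "openin ?T (?S j)" if op: "openin (top_of_set (cball 0 1)) (F j)" for j
    proof -
      obtain W where "open W" "F j = cball 0 1 \<inter> W"
        using op unfolding openin_open by blast
      then have "?S j = sphere 0 1 \<inter> W"
        by auto
      with \<open>open W\<close> show ?thesis
        by (auto simp: openin_open)
    qed
    with False F have "\<forall>j\<in>?I. closedin (top_of_set (cball 0 1)) (F j)"
      by (auto simp: is_cover_def)
    then have F_compact: "compact (F j)" if "j \<in> ?I" for j
      using that closedin_compact[OF compact_cball] by blast
    obtain \<delta> where \<delta>: "\<delta> > 0" "\<And>j x y. \<lbrakk>j \<in> ?I; x \<in> F j; y \<in> F (- j)\<rbrakk> \<Longrightarrow> \<delta> \<le> dist x y"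
      using uniform_separation[of ?I F "\<lambda>j. F (- j)"] F_compact F_disj
        finite_signed_indices[of n] by (metis compact_imp_closed uminus_signed_indices)
    \<comment> \<open>half the separation keeps opposite neighbourhoods disjoint\<close>
    define U where "U j = sphere 0 1 \<inter> (\<Union>y\<in>F j. ball y (\<delta> / 2))" for j
    have "U j \<inter> U (- j) = {}" if "j \<in> ?I" for j
    proof (rule ccontr)
      assume "U j \<inter> U (- j) \<noteq> {}"
      then obtain x y z where "y \<in> F j" "dist y x < \<delta> / 2" "z \<in> F (- j)" "dist z x < \<delta> / 2"
        by (auto simp: U_def)
      with \<delta>(2)[OF that, of y z] dist_triangle_half_l[of y x \<delta> z] show False
        by auto
    qed
    then have "balanced_free ?I ?v U"
      by (simp add: balanced_free_signed_iff[OF e])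
    moreover have "openin ?T (U j)" for j
      unfolding U_def by (intro openin_open_Int open_UN ballI open_ball)
    moreover have sub: "?S j \<subseteq> U j" for j
      using \<delta>(1) by (auto simp: U_def)
    moreover have "(\<Union>j\<in>?I. U j) = sphere 0 1"
    proof
      have "(\<Union>j\<in>?I. F j) = cball 0 1"
        using F by (simp add: is_cover_def)
      then show "sphere 0 1 \<subseteq> (\<Union>j\<in>?I. U j)"
        using sub by fastforce
    qed (auto simp: U_def)
    ultimately have "open_enlargement ?T ?I ?v ?S U"
      by (auto simp: open_enlargement_def is_cover_def finite_signed_indices)
    then have V: "open_enlargement ?T ?I ?v ?S (SOME U. open_enlargement ?T ?I ?v ?S U)"
      by (rule someI[where P = "open_enlargement ?T ?I ?v ?S"])
    have "null_class ?T (top_of_set (sphere 0 1))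
        (open_cover_class ?T ?I ?v (SOME U. open_enlargement ?T ?I ?v ?S U))"
    proof (rule null)
      show "G j \<inter> sphere 0 1 \<subseteq> (SOME U. open_enlargement ?T ?I ?v ?S U) j" if "j \<in> ?I" for j
        using V G(2)[OF that] that unfolding open_enlargement_def by blast
    qed (use V in \<open>simp_all add: open_enlargement_def\<close>)
    with False show ?thesis
      by (simp only: cover_class_def if_False)
  qed
  with S show False
    by (simp add: not_null_homotopic_cover_def)
qed

theorem corollary4p3:
  fixes n k :: nat
    and e :: "nat \<Rightarrow> real ^ 'n"
    and F :: "int \<Rightarrow> (real ^ 'k) set"
  assumes "n = CARD('n)" and "k = CARD('k)"
    and "inj_on e {1..n}" and "independent (e ` {1..n})" and "span (e ` {1..n}) = UNIV"
    and "is_cover (top_of_set (cball 0 1)) (signed_indices n) F"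
  shows "(not_null_homotopic_cover (top_of_set (sphere 0 1)) (signed_indices n) (signed_vector e)
            (\<lambda>j. F j \<inter> sphere 0 1) \<longrightarrow>
          (\<exists>i\<in>{1..n}. F (int i) \<inter> F (- int i) \<noteq> {})) \<and>
         (n \<le> k \<longrightarrow> antipodal_on_sphere n F \<longrightarrow>
          (\<exists>i\<in>{1..n}. F (int i) \<inter> F (- int i) \<noteq> {}))"
proof (intro conjI impI)
  show "\<exists>i\<in>{1..n}. F (int i) \<inter> F (- int i) \<noteq> {}"
    if "not_null_homotopic_cover (top_of_set (sphere 0 1)) (signed_indices n) (signed_vector e)
          (\<lambda>j. F j \<inter> sphere 0 1)"
    using assms(3,4,6) that by (rule not_null_homotopic_cover_meets)
  show "\<exists>i\<in>{1..n}. F (int i) \<inter> F (- int i) \<noteq> {}" if "n \<le> k" "antipodal_on_sphere n F"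
    using that assms(2,6) by (intro antipodal_on_sphere_cover_meets) auto
qed

end
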